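(* Let $X=\{0,1\}^{\mathbb{N}}$ and let $f:X\to\mathbb{R}$ be Lipschitz with $f>0$. Suppose $\mu_\infty$ is the unique maximizing probability for $f$, i.e. $M_{max}(f)=\{\mu_\infty\}$. Then there exists a cylinder $k\subset X$ such that $$\inf_{x\in k}\widetilde I(x)\neq\inf_{x\in k}I_{BLT}(x).$$
   Context: $\sigma$ is the shift on $X$, with metric $d(x,y)=\theta^{N}$, where $N$ is the first index with $x_N\ne y_N$ (and $d(x,x)=0$), $0<\theta<1$ fixed; Lipschitz is with respect to this metric. A cylinder is a set $\{x\in X: x_1=a_1,\dots,x_m=a_m\}$. $\mathcal{M}$ is the set of $\sigma$-invariant Borel probabilities, $\beta(f)=\sup_{\nu\in\mathcal{M}}\int f\,d\nu$, $M_{max}(f)=\{\nu\in\mathcal{M}:\int f\,d\nu=\beta(f)\}$. $f^n(x)=\sum_{i=0}^{n-1}f(\sigma^i x)$. $\mathrm{PER}$ is the set of periodic points of $\sigma$ and $n_x$ the minimal period of $x\in\mathrm{PER}$. For $x\in\mathrm{PER}$, $I(x)=n_x\beta(f)-f^{n_x}(x)$. For $x\in X$, $$\widetilde I(x)=\lim_{\epsilon\to0}\Big(\inf\{I(y): y\in\mathrm{PER},\ d(y,x)\le\epsilon\}\Big)\in[0,\infty].$$ $\mu_{cf}$ denotes the equilibrium state (Gibbs state) of $cf$, $c>0$. $I_{BLT}:X\to[0,\infty]$ is the non-negative lower semi-continuous deviation function of Baraviera, Lopes and Thieullen for the family $\mu_{cf}$, $c\to\infty$: when $M_{max}(f)$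 is a singleton it exists, and it is the (necessarily unique) lower semi-continuous function such that for every cylinder $k\subset X$ $$\lim_{c\to\infty}\frac1c\log\mu_{cf}(k)=-\inf_{x\in k}I_{BLT}(x).$$ *)

theory Defs
  imports "HOL-Probability.Probability"
begin

section \<open>The one-sided full shift on two symbols\<close>

text \<open>
  Points of \<open>X\<close> are functions \<^typ>\<open>nat \<Rightarrow> bool\<close>, with \<open>x i\<close> holding the coordinate
  \<open>x\<^sub>i\<^sub>+\<^sub>1\<close>. Topology and Borel sets are those of the library's product topology on functions
  (\<^typ>\<open>bool\<close> is discrete); \<open>open_iff_shift_dist\<close> below identifies it with the topology of the
  metric \<open>shift_dist\<close>.
\<close>

type_synonym point = "nat \<Rightarrow> bool"

definition shift :: "point \<Rightarrow> point" where
  "shift x = (\<lambda>i. x (Suc i))"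

text \<open>The \<open>Suc\<close> is due to coordinates being numbered from 1 in the definition of the metric.\<close>

definition shift_dist :: "real \<Rightarrow> point \<Rightarrow> point \<Rightarrow> real" where
  "shift_dist \<theta> x y = (if x = y then 0 else \<theta> ^ Suc (LEAST i. x i \<noteq> y i))"

definition lipschitz_shift :: "real \<Rightarrow> (point \<Rightarrow> real) \<Rightarrow> bool" where
  "lipschitz_shift \<theta> f \<longleftrightarrow> (\<exists>L. \<forall>x y. \<bar>f x - f y\<bar> \<le> L * shift_dist \<theta> x y)"

definition is_cylinder :: "point set \<Rightarrow> bool" where
  "is_cylinder k \<longleftrightarrow> (\<exists>m\<ge>1. \<exists>a :: nat \<Rightarrow> bool. k = {x. \<forall>i<m. x i = a i})"

lemma shift_dist_less_iff:
  assumes "0 < \<theta>" "\<theta> < 1"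
  shows "shift_dist \<theta> y x < \<theta> ^ n \<longleftrightarrow> (\<forall>i<n. y i = x i)"
proof (cases "y = x")
  case True
  then show ?thesis using assms by (simp add: shift_dist_def)
next
  case False
  define N where "N = (LEAST i. y i \<noteq> x i)"
  from False have "\<exists>i. y i \<noteq> x i" by auto
  then have N: "y N \<noteq> x N" unfolding N_def by (rule LeastI_ex)
  have below: "y i = x i" if "i < N" for i
    using not_less_Least[of i "\<lambda>i. y i \<noteq> x i"] that by (auto simp: N_def)
  have "shift_dist \<theta> y x = \<theta> ^ Suc N"
    unfolding shift_dist_def N_def if_not_P[OF False] ..
  then have "shift_dist \<theta> y x < \<theta> ^ n \<longleftrightarrow> n < Suc N"
    using power_strict_decreasing_iff[OF assms] by (simp only:)
  also have "\<dots> \<longleftrightarrow> (\<forall>i<n. y i = x i)"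
  proof
    assume "n < Suc N"
    then show "\<forall>i<n. y i = x i" using below by simp
  next
    assume "\<forall>i<n. y i = x i"
    then have "\<not> N < n" using N by blast
    then show "n < Suc N" by simp
  qed
  finally show ?thesis .
qed

lemma open_iff_shift_dist:
  assumes "0 < \<theta>" "\<theta> < 1"
  shows "open U \<longleftrightarrow> (\<forall>x\<in>U. \<exists>e>0. \<forall>y. shift_dist \<theta> y x < e \<longrightarrow> y \<in> U)"
proof safe
  fix x assume "open U" "x \<in> U"
  then have "openin (product_topology (\<lambda>_. euclidean) UNIV) U" by (simp only: open_fun_def)
  from product_topology_open_contains_basis[OF this \<open>x \<in> U\<close>]
  obtain B where B: "x \<in> Pi\<^sub>E UNIV B" "finite {i. B i \<noteq> UNIV}" "Pi\<^sub>E UNIV B \<subseteq> U"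
    unfolding topspace_euclidean by (elim exE conjE) (rule that)
  obtain n where n: "\<forall>i\<in>{i. B i \<noteq> UNIV}. i < n"
    using B(2)[unfolded finite_nat_set_iff_bounded] ..
  have "y \<in> U" if y: "shift_dist \<theta> y x < \<theta> ^ n" for y
  proof -
    have eq: "\<forall>i<n. y i = x i" using y by (simp only: shift_dist_less_iff[OF assms])
    have "y i \<in> B i" for i
    proof (cases "i < n")
      case True
      then have "y i = x i" using eq by blast
      then show ?thesis using PiE_mem[OF B(1), of i] by simp
    next
      case False
      then have "B i = UNIV" using n by blast
      then show ?thesis by simp
    qed
    then have "y \<in> Pi\<^sub>E UNIV B" by (intro PiE_I) simp_all
    then show ?thesis by (rule subsetD[OF B(3)])
  qed
  then show "\<exists>e>0. \<forall>y. shift_dist \<theta> y x < e \<longrightarrow> y \<in> U"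
    using assms by (intro exI[of _ "\<theta> ^ n"]) auto
next
  assume *: "\<forall>x\<in>U. \<exists>e>0. \<forall>y. shift_dist \<theta> y x < e \<longrightarrow> y \<in> U"
  show "open U"
  proof (subst open_subopen, intro ballI)
    fix x assume "x \<in> U"
    then obtain e where e: "e > 0" "\<And>y. shift_dist \<theta> y x < e \<Longrightarrow> y \<in> U" using * by blast
    obtain n where n: "\<theta> ^ n < e" using real_arch_pow_inv[OF e(1) assms(2)] by blast
    let ?C = "Pi\<^sub>E UNIV (\<lambda>i. if i < n then {x i} else UNIV)"
    have "open ?C"
    proof (rule open_PiE)
      show "finite {i. (if i < n then {x i} else UNIV) \<noteq> UNIV}"
        by (rule finite_subset[of _ "{..<n}"]) (auto split: if_splits)
    qed (rule discrete_topology_class.open_discrete)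
    moreover have "?C \<subseteq> U"
    proof
      fix y assume y: "y \<in> ?C"
      have "\<forall>i<n. y i = x i"
      proof (intro allI impI)
        fix i assume "i < n"
        then show "y i = x i" using PiE_mem[OF y, of i] by simp
      qed
      then have "shift_dist \<theta> y x < \<theta> ^ n" by (simp only: shift_dist_less_iff[OF assms])
      then show "y \<in> U" by (intro e(2)) (use n in linarith)
    qed
    ultimately show "\<exists>T. open T \<and> x \<in> T \<and> T \<subseteq> U" by (intro exI[of _ ?C]) (simp add: PiE_iff)
  qed
qed


section \<open>Ergodic optimization\<close>

definition invariant_probs :: "point measure set" where
  "invariant_probs = {\<nu>. prob_space \<nu> \<and> sets \<nu> = sets borel \<and> distr \<nu> borel shift = \<nu>}"

definition max_mean :: "(point \<Rightarrow> real) \<Rightarrow> real" where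
  "max_mean f = (SUP \<nu>\<in>invariant_probs. integral\<^sup>L \<nu> f)"

definition maximizing_probs :: "(point \<Rightarrow> real) \<Rightarrow> point measure set" where
  "maximizing_probs f = {\<nu> \<in> invariant_probs. integral\<^sup>L \<nu> f = max_mean f}"

definition birkhoff_sum :: "(point \<Rightarrow> real) \<Rightarrow> nat \<Rightarrow> point \<Rightarrow> real" where
  "birkhoff_sum f n x = (\<Sum>i<n. f ((shift ^^ i) x))"

definition periodic_points :: "point set" where
  "periodic_points = {x. \<exists>n\<ge>1. (shift ^^ n) x = x}"

definition min_period :: "point \<Rightarrow> nat" where
  "min_period x = (LEAST n. n \<ge> 1 \<and> (shift ^^ n) x = x)"

definition periodic_cost :: "(point \<Rightarrow> real) \<Rightarrow> point \<Rightarrow> real" where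
  "periodic_cost f x = real (min_period x) * max_mean f - birkhoff_sum f (min_period x) x"

definition tilde_I :: "real \<Rightarrow> (point \<Rightarrow> real) \<Rightarrow> point \<Rightarrow> ereal" where
  "tilde_I \<theta> f x =
     Lim (at_right (0::real))
       (\<lambda>\<epsilon>. INF y\<in>{y \<in> periodic_points. shift_dist \<theta> y x \<le> \<epsilon>}. ereal (periodic_cost f y))"


section \<open>Entropy and equilibrium states\<close>

text \<open>
  A finite measurable partition is given by a simple function \<open>\<xi>\<close> with values in \<^typ>\<open>nat\<close>, its
  atoms being the level sets. The partition \<open>\<xi> \<or> T\<^sup>-\<^sup>1 \<xi> \<or> \<dots> \<or> T\<^sup>-\<^sup>(\<^sup>n\<^sup>-\<^sup>1\<^sup>) \<xi>\<close> is then the one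
  given by the \<open>n\<close>-block itinerary.
\<close>

definition itinerary :: "('a \<Rightarrow> 'a) \<Rightarrow> ('a \<Rightarrow> nat) \<Rightarrow> nat \<Rightarrow> 'a \<Rightarrow> nat list" where
  "itinerary T \<xi> n x = map (\<lambda>i. \<xi> ((T ^^ i) x)) [0..<n]"

definition shannon_entropy :: "'a measure \<Rightarrow> ('a \<Rightarrow> 'b) \<Rightarrow> real" where
  "shannon_entropy M X = prob_space.entropy M (exp 1) (count_space (X ` space M)) X"

definition partition_entropy :: "'a measure \<Rightarrow> ('a \<Rightarrow> 'a) \<Rightarrow> ('a \<Rightarrow> nat) \<Rightarrow> real" where
  "partition_entropy M T \<xi> = lim (\<lambda>n. shannon_entropy M (itinerary T \<xi> n) / real n)"

definition ks_entropy :: "'a measure \<Rightarrow> ('a \<Rightarrow> 'a) \<Rightarrow> ereal" where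
  "ks_entropy M T = (SUP \<xi>\<in>{\<xi>. simple_function M \<xi>}. ereal (partition_entropy M T \<xi>))"

definition pressure :: "(point \<Rightarrow> real) \<Rightarrow> ereal" where
  "pressure g = (SUP \<nu>\<in>invariant_probs. ks_entropy \<nu> shift + ereal (integral\<^sup>L \<nu> g))"

definition equilibrium_state :: "(point \<Rightarrow> real) \<Rightarrow> point measure \<Rightarrow> bool" where
  "equilibrium_state g \<mu> \<longleftrightarrow>
     \<mu> \<in> invariant_probs \<and> ks_entropy \<mu> shift + ereal (integral\<^sup>L \<mu> g) = pressure g"


section \<open>The deviation function at zero temperature\<close>

definition lower_semicontinuous :: "(point \<Rightarrow> ereal) \<Rightarrow> bool" where
  "lower_semicontinuous g \<longleftrightarrow> (\<forall>t. open {x. t < g x})"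

text \<open>The logarithm of a probability, with \<open>log 0 = -\<infinity>\<close> (whereas \<open>ln 0 = 0\<close> in the library).\<close>

definition log_measure :: "'a measure \<Rightarrow> 'a set \<Rightarrow> ereal" where
  "log_measure M A = (if measure M A = 0 then -\<infinity> else ereal (ln (measure M A)))"

definition is_BLT_deviation :: "(real \<Rightarrow> point measure) \<Rightarrow> (point \<Rightarrow> ereal) \<Rightarrow> bool" where
  "is_BLT_deviation \<mu> I \<longleftrightarrow>
     (\<forall>x. 0 \<le> I x) \<and> lower_semicontinuous I \<and>
     (\<forall>k. is_cylinder k \<longrightarrow>
        ((\<lambda>c. ereal (1 / c) * log_measure (\<mu> c) k) \<longlongrightarrow> - (INF x\<in>k. I x)) at_top)"

end

theory Submission
  imports Defs
begin

text \<open>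
  One of the two fixed points \<open>p = bbb\<dots>\<close> of the shift is not maximizing, so \<open>\<Delta> = \<beta>(f) - f(p) > 0\<close>.
  Being periodic, \<open>p\<close> keeps the infimum of \<open>tilde_I\<close> over every cylinder around it at most \<open>\<Delta>\<close>.
  The deviation function of the equilibrium states is, on the contrary, unbounded along the
  cylinders \<open>[b\<^sup>m]\<close>, because \<open>\<mu>\<^sub>c[b\<^sup>m] \<le> 2 exp (c (3 D - m \<Delta>))\<close> with a distortion constant \<open>D\<close>.

  This bound is derived from the variational principle without transfer operators. Let \<open>P\<close> be the
  pressure of \<open>g = c f\<close> and \<open>Z n\<close> the sum of \<open>exp (S\<^sub>n g)\<close> over words of length \<open>n\<close>. An invariant
  measure built from independent blocks with weights \<open>exp (S\<^sub>n g)\<close> shows \<open>Z n \<le> exp (n P + c D)\<close>.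
  Gibbs' inequality, applied to an equilibrium state and to the weights \<open>exp (S\<^sub>n\<^sub>m g)\<close> multiplied by 2
  for each aligned block \<open>b\<^sup>m\<close>, gives \<open>n m P + n ln 2 \<mu>\<^sub>c[b\<^sup>m] \<le> ln F n + c D\<close>, and a renewal inequality
  bounds the weighted sum \<open>F n\<close> by \<open>exp (c D + n m P) (1 + \<kappa>)\<^sup>n\<close> with
  \<open>\<kappa> = exp (m (g p - P) + 3 c D)\<close>. Dividing by \<open>n\<close> yields \<open>ln 2 \<mu>\<^sub>c[b\<^sup>m] \<le> \<kappa>\<close>, and \<open>P \<ge> c \<beta>(f)\<close>.
\<close>

section \<open>Shannon entropy of simple functions\<close>

context prob_space
begin

lemma integral_simple_image:
  fixes g :: "'b \<Rightarrow> real"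
  assumes "simple_function M X"
  shows "(\<integral>\<omega>. g (X \<omega>) \<partial>M) = (\<Sum>a\<in>X ` space M. g a * prob (X -` {a} \<inter> space M))"
proof -
  have fin: "finite (X ` space M)" and ms: "\<And>a. X -` {a} \<inter> space M \<in> sets M"
    using simple_functionD[OF assms] by auto
  have "(\<integral>\<omega>. g (X \<omega>) \<partial>M) = (\<integral>\<omega>. (\<Sum>a\<in>X ` space M. g a * indicator (X -` {a} \<inter> space M) \<omega>) \<partial>M)"
  proof (rule Bochner_Integration.integral_cong[OF refl])
    fix \<omega> assume w: "\<omega> \<in> space M"
    have "(\<Sum>a\<in>X ` space M. g a * indicator (X -` {a} \<inter> space M) \<omega>)
        = (\<Sum>a\<in>X ` space M. if X \<omega> = a then g a else (0::real))"
      using w by (intro sum.cong) (auto simp: indicator_def)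
    then show "g (X \<omega>) = (\<Sum>a\<in>X ` space M. g a * indicator (X -` {a} \<inter> space M) \<omega>)"
      using w fin by simp
  qed
  also have "\<dots> = (\<Sum>a\<in>X ` space M. g a * prob (X -` {a} \<inter> space M))"
    using ms by (subst Bochner_Integration.integral_sum) (auto simp: emeasure_eq_measure)
  finally show ?thesis .
qed

lemma sum_prob_simple_image:
  assumes "simple_function M X"
  shows "(\<Sum>a\<in>X ` space M. prob (X -` {a} \<inter> space M)) = 1"
  using integral_simple_image[OF assms, of "\<lambda>_. 1"] by (simp add: prob_space)

lemma integrable_simple_image:
  fixes g :: "'b \<Rightarrow> real"
  assumes "simple_function M X"
  shows "integrable M (\<lambda>\<omega>. g (X \<omega>))"
proof -
  have "simple_function M (\<lambda>\<omega>. g (X \<omega>))"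
    using assms by (rule simple_function_compose1)
  then show ?thesis
    by (rule integrable_simple_function) (simp add: emeasure_eq_measure)
qed

text \<open>Writing entropy as the mean of the information function lets invariance act on it by
  change of variables and lets other logarithmic integrals be added to it. Null atoms do no harm,
  since they carry no mass.\<close>

lemma shannon_entropy_eq:
  assumes "simple_function M X"
  shows "shannon_entropy M X = - (\<integral>\<omega>. ln (prob (X -` {X \<omega>} \<inter> space M)) \<partial>M)"
proof -
  interpret information_space M "exp 1" by standard auto
  have "entropy (exp 1) (count_space (X ` space M)) X = - (\<Sum>a\<in>X ` space M. prob (X -` {a} \<inter> space M) * ln (prob (X -` {a} \<inter> space M)))"
    using entropy_simple_distributed[OF simple_distributedI[OF assms measure_nonneg refl]]
    by (simp add: log_def)
  then show ?thesis
    unfolding shannon_entropy_def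
    by (subst integral_simple_image[OF assms, of "\<lambda>a. ln (prob (X -` {a} \<inter> space M))"])
       (simp add: mult.commute)
qed

text \<open>Non-negativity of relative entropy: \<open>ln t \<le> t - 1\<close> at the ratio of
  \<open>q a\<close> to \<open>p a * Z\<close>, averaged against \<open>p\<close>. The weights
  \<open>q\<close> are not normalised. They must be positive on charged atoms because
  \<open>ln 0 = 0\<close> here.\<close>

lemma gibbs_inequality:
  assumes X: "simple_function M X"
    and q: "\<And>a. a \<in> X ` space M \<Longrightarrow> 0 \<le> q a"
    and qpos: "\<And>a. a \<in> X ` space M \<Longrightarrow> 0 < prob (X -` {a} \<inter> space M) \<Longrightarrow> 0 < q a"
    and Z: "(\<Sum>a\<in>X ` space M. q a) \<le> Z"
  shows "shannon_entropy M X + (\<integral>\<omega>. ln (q (X \<omega>)) \<partial>M) \<le> ln Z"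
proof -
  define p where "p a = prob (X -` {a} \<inter> space M)" for a
  let ?A = "X ` space M"
  have fin: "finite ?A" using X by (auto simp: simple_function_def)
  have p0: "0 \<le> p a" for a by (simp add: p_def)
  have psum: "(\<Sum>a\<in>?A. p a) = 1" unfolding p_def by (rule sum_prob_simple_image[OF X])
  \<comment> \<open>A charged atom has positive weight, which makes \<open>Z\<close> positive and
    \<open>ln Z\<close> meaningful.\<close>
  have "\<exists>a\<in>?A. 0 < p a"
  proof (rule ccontr)
    assume "\<not> ?thesis"
    then have "(\<Sum>a\<in>?A. p a) = 0" using p0 by (intro sum.neutral) (auto simp: antisym not_less)
    then show False using psum by simp
  qed
  then obtain a where a: "a \<in> ?A" "0 < p a" by blast
  then have "0 < q a" using qpos by (simp add: p_def)
  also have "q a \<le> (\<Sum>a\<in>?A. q a)" using a q fin by (intro member_le_sum) auto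
  finally have Zpos: "0 < Z" using Z by simp
  have bound: "p a * ln (q a) - p a * ln (p a) - p a * ln Z \<le> q a / Z - p a" if "a \<in> ?A" for a
  proof (cases "p a = 0")
    case True
    then show ?thesis using q[OF that] Zpos by simp
  next
    case False
    then have pa: "0 < p a" using p0[of a] by simp
    then have qa: "0 < q a" using qpos[OF that] by (simp add: p_def)
    have "ln (q a) - ln (p a) - ln Z = ln (q a / (p a * Z))"
      using pa qa Zpos by (simp add: ln_div ln_mult)
    also have "\<dots> \<le> q a / (p a * Z) - 1" using pa qa Zpos by (intro ln_le_minus_one) simp
    finally have "p a * (ln (q a) - ln (p a) - ln Z) \<le> p a * (q a / (p a * Z) - 1)"
      using pa by (intro mult_left_mono) auto
    then show ?thesis using pa by (simp add: field_simps)
  qed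
  have "shannon_entropy M X + (\<integral>\<omega>. ln (q (X \<omega>)) \<partial>M) - ln Z
      = (\<Sum>a\<in>?A. p a * ln (q a) - p a * ln (p a) - p a * ln Z)"
    unfolding shannon_entropy_eq[OF X]
      integral_simple_image[OF X, of "\<lambda>a. ln (prob (X -` {a} \<inter> space M))"]
      integral_simple_image[OF X, of "\<lambda>a. ln (q a)"]
    by (simp add: sum_subtractf p_def[symmetric] psum mult.commute flip: sum_distrib_left)
  also have "\<dots> \<le> (\<Sum>a\<in>?A. q a / Z - p a)"
    by (intro sum_mono bound)
  also have "\<dots> \<le> 0" using Z Zpos psum by (simp add: sum_subtractf flip: sum_divide_distrib)
  finally show ?thesis by simp
qed

lemma shannon_entropy_compose_le:
  assumes "simple_function M X"
  shows "shannon_entropy M (\<lambda>\<omega>. h (X \<omega>)) \<le> shannon_entropy M X"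
proof -
  interpret information_space M "exp 1" by standard auto
  show ?thesis
    using entropy_data_processing[OF assms, of h] by (simp add: shannon_entropy_def comp_def)
qed

lemma shannon_entropy_nonneg:
  assumes "simple_function M X"
  shows "0 \<le> shannon_entropy M X"
proof -
  have "ln (prob (X -` {X \<omega>} \<inter> space M)) \<le> 0" for \<omega>
    by (cases "prob (X -` {X \<omega>} \<inter> space M) = 0") (auto simp: zero_less_measure_iff)
  then show ?thesis
    unfolding shannon_entropy_eq[OF assms] using integral_nonneg_AE[of "\<lambda>\<omega>. - ln (prob (X -` {X \<omega>} \<inter> space M))" M]
    by simp
qed

text \<open>There are finitely many level sets, so the null ones have null union. Almost everywhere,
  logarithms of products of probabilities may therefore be split.\<close>

lemma AE_simple_image_pos:
  assumes X: "simple_function M X"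
  shows "AE \<omega> in M. 0 < prob (X -` {X \<omega>} \<inter> space M)"
proof -
  let ?N = "\<Union>a\<in>{a \<in> X ` space M. prob (X -` {a} \<inter> space M) = 0}. X -` {a} \<inter> space M"
  have "?N \<in> null_sets M"
    using X by (intro null_sets.finite_UN) (auto simp: simple_function_def emeasure_eq_measure)
  then show ?thesis
    by (rule AE_I') (auto simp: not_less measure_le_0_iff)
qed

text \<open>The chain rule as an inequality: \<open>k x y\<close> is any guess for the conditional probability of
  \<open>Y = y\<close> given \<open>X = x\<close>.\<close>

lemma shannon_entropy_Pair_le:
  fixes X :: "'a \<Rightarrow> 'b" and Y :: "'a \<Rightarrow> 'c"
  assumes X: "simple_function M X" and Y: "simple_function M Y"
    and k: "\<And>x y. 0 \<le> k x y"
    and kpos: "\<And>\<omega>. \<omega> \<in> space M \<Longrightarrow> 0 < prob (Y -` {Y \<omega>} \<inter> space M) \<Longrightarrow> 0 < k (X \<omega>) (Y \<omega>)"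
    and ksum: "\<And>x. (\<Sum>y\<in>Y ` space M. k x y) \<le> 1"
  shows "shannon_entropy M (\<lambda>\<omega>. (X \<omega>, Y \<omega>)) \<le> shannon_entropy M X - (\<integral>\<omega>. ln (k (X \<omega>) (Y \<omega>)) \<partial>M)"
proof -
  let ?p = "\<lambda>a. prob (X -` {a} \<inter> space M)"
  let ?XY = "\<lambda>\<omega>. (X \<omega>, Y \<omega>)"
  have XY: "simple_function M ?XY" using X Y by (rule simple_function_Pair)
  have fin: "finite (X ` space M)" "finite (Y ` space M)" using X Y by (auto simp: simple_function_def)
  have ms: "X -` {a} \<inter> space M \<in> sets M" "Y -` {b} \<inter> space M \<in> sets M" for a b
    using X Y simple_functionD by auto
  \<comment> \<open>The true law of \<open>X\<close> combined with the guessed kernel is a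
    sub-probability on pairs, so Gibbs' inequality applies with total weight at most 1.\<close>
  let ?q = "\<lambda>(x, y). ?p x * k x y"
  have "shannon_entropy M ?XY + (\<integral>\<omega>. ln (?q (?XY \<omega>)) \<partial>M) \<le> ln 1"
  proof (rule gibbs_inequality[OF XY])
    fix a assume "a \<in> ?XY ` space M"
    then obtain \<omega> where w: "\<omega> \<in> space M" "a = ?XY \<omega>" by auto
    show "0 \<le> ?q a" using k w by auto
    assume "0 < prob (?XY -` {a} \<inter> space M)"
    moreover have "prob (?XY -` {a} \<inter> space M) \<le> ?p (X \<omega>)"
      "prob (?XY -` {a} \<inter> space M) \<le> prob (Y -` {Y \<omega>} \<inter> space M)"
      using w by (auto intro!: finite_measure_mono ms)
    ultimately show "0 < ?q a" using kpos w by auto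
  next
    have "(\<Sum>a\<in>?XY ` space M. ?q a) \<le> (\<Sum>a\<in>X ` space M \<times> Y ` space M. ?q a)"
      using fin k by (intro sum_mono2) auto
    also have "\<dots> = (\<Sum>x\<in>X ` space M. ?p x * (\<Sum>y\<in>Y ` space M. k x y))"
      by (simp add: sum.cartesian_product[symmetric] sum_distrib_left)
    also have "\<dots> \<le> (\<Sum>x\<in>X ` space M. ?p x * 1)"
      using ksum by (intro sum_mono mult_left_mono) auto
    also have "\<dots> = 1" using sum_prob_simple_image[OF X] by simp
    finally show "(\<Sum>a\<in>?XY ` space M. ?q a) \<le> 1" .
  qed
  moreover have "(\<integral>\<omega>. ln (?q (?XY \<omega>)) \<partial>M)
      = (\<integral>\<omega>. ln (?p (X \<omega>)) + ln (k (X \<omega>) (Y \<omega>)) \<partial>M)"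
  proof (rule integral_cong_AE)
    show "(\<lambda>\<omega>. ln (?q (?XY \<omega>))) \<in> borel_measurable M"
      using integrable_simple_image[OF XY, of "\<lambda>a. ln (?q a)"] by simp
    show "(\<lambda>\<omega>. ln (?p (X \<omega>)) + ln (k (X \<omega>) (Y \<omega>))) \<in> borel_measurable M"
      using integrable_simple_image[OF XY, of "\<lambda>a. ln (?p (fst a)) + ln (k (fst a) (snd a))"] by simp
    show "AE \<omega> in M. ln (?q (?XY \<omega>)) = ln (?p (X \<omega>)) + ln (k (X \<omega>) (Y \<omega>))"
      using AE_simple_image_pos[OF X] AE_simple_image_pos[OF Y] AE_space
    proof eventually_elim
      case (elim \<omega>)
      then show ?case using kpos[of \<omega>] by (simp add: ln_mult)
    qed
  qed
  moreover have "\<dots> = (\<integral>\<omega>. ln (?p (X \<omega>)) \<partial>M) + (\<integral>\<omega>. ln (k (X \<omega>) (Y \<omega>)) \<partial>M)"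
    using integrable_simple_image[OF X, of "\<lambda>a. ln (?p a)"]
      integrable_simple_image[OF XY, of "\<lambda>a. ln (k (fst a) (snd a))"]
    by (intro Bochner_Integration.integral_add) auto
  ultimately show ?thesis using shannon_entropy_eq[OF X] by simp
qed

text \<open>The guess that ignores \<open>X\<close> and uses the law of \<open>Y\<close> turns the
  chain inequality into subadditivity.\<close>

lemma shannon_entropy_Pair_le_add:
  assumes X: "simple_function M X" and Y: "simple_function M Y"
  shows "shannon_entropy M (\<lambda>\<omega>. (X \<omega>, Y \<omega>)) \<le> shannon_entropy M X + shannon_entropy M Y"
  using shannon_entropy_Pair_le[OF X Y, of "\<lambda>_ y. prob (Y -` {y} \<inter> space M)"]
    sum_prob_simple_image[OF Y] shannon_entropy_eq[OF Y] by simp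

end

text \<open>Fekete's lemma: with \<open>N\<close> nearly optimal and \<open>n = q * N + r\<close>,
  the remainder costs at most the constant \<open>B\<close>, which division by \<open>n\<close>
  removes.\<close>

lemma subadditive_tendsto_Inf:
  fixes a :: "nat \<Rightarrow> real"
  assumes sub: "\<And>m n. a (m + n) \<le> a m + a n" and nonneg: "\<And>n. 0 \<le> a n"
  shows "(\<lambda>n. a n / n) \<longlonglongrightarrow> (INF n\<in>{1..}. a n / n)"
proof (rule LIMSEQ_I)
  let ?L = "INF n\<in>{1..}. a n / real n"
  have bdd: "bdd_below ((\<lambda>n. a n / real n) ` {1..})"
    using nonneg by (auto intro!: bdd_belowI[of _ 0])
  fix e :: real assume e: "0 < e"
  obtain N where N: "1 \<le> N" "a N / N < ?L + e / 2"
    using cInf_lessD[of "(\<lambda>n. a n / real n) ` {1..}" "?L + e / 2"] e by auto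
  define B where "B = Max (a ` {..<N})"
  have B: "a r \<le> B" if "r < N" for r unfolding B_def using that by auto
  have mul: "a (q * N + r) \<le> q * a N + a r" for q r
  proof (induction q)
    case (Suc q)
    have "a (Suc q * N + r) \<le> a N + a (q * N + r)"
      using sub[of N "q * N + r"] by (simp add: add.assoc)
    then show ?case using Suc by (simp add: algebra_simps)
  qed simp
  obtain K where K: "real K > 2 * B / e" using reals_Archimedean2 by blast
  show "\<exists>no. \<forall>n\<ge>no. norm (a n / n - ?L) < e"
  proof (intro exI allI impI)
    fix n assume n: "Suc K \<le> n"
    then have n1: "0 < n" by simp
    have "a n \<le> (n div N) * a N + a (n mod N)" using mul[of "n div N" "n mod N"] by simp
    also have "\<dots> \<le> (n div N) * a N + B" using B N by simp
    also have "\<dots> \<le> (n / N) * a N + B"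
      using nonneg[of N] of_nat_mono[of "N * (n div N)" n, where 'a = real] N
      by (intro add_right_mono mult_right_mono) (simp_all add: field_simps)
    finally have "a n / n \<le> a N / N + B / n"
      using n1 by (simp add: field_simps)
    moreover have "B / n < e / 2"
    proof -
      have "2 * B / e < n" using K n by linarith
      then show ?thesis using e n1 by (simp add: field_simps)
    qed
    moreover have "?L \<le> a n / n" using n1 bdd by (intro cINF_lower) auto
    ultimately show "norm (a n / n - ?L) < e" using N(2) e unfolding real_norm_def by linarith
  qed
qed

section \<open>Cylinder partitions of the shift\<close>

text \<open>A word of length \<open>n\<close> is encoded as the point that continues it by the
  constant \<open>b\<close>. Words of all lengths thus share one type, and Birkhoff sums can be
  evaluated at them directly.\<close>

definition trunc :: "bool \<Rightarrow> nat \<Rightarrow> point \<Rightarrow> point" where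
  "trunc b n x = (\<lambda>i. if i < n then x i else b)"

definition words :: "bool \<Rightarrow> nat \<Rightarrow> point set" where
  "words b n = {x. \<forall>i\<ge>n. x i = b}"

lemma funpow_shift: "(shift ^^ n) x = (\<lambda>i. x (n + i))"
  by (induction n arbitrary: x) (auto simp: shift_def funpow_swap1)

lemma trunc_eq_iff: "trunc b n x = trunc b n y \<longleftrightarrow> (\<forall>i<n. x i = y i)"
  by (auto simp: trunc_def fun_eq_iff)

lemma trunc_in_words [simp]: "trunc b n x \<in> words b n"
  by (simp add: trunc_def words_def)

lemma trunc_words: "x \<in> words b n \<Longrightarrow> trunc b n x = x"
  by (auto simp: trunc_def words_def fun_eq_iff)

lemma trunc_trunc: "m \<le> n \<Longrightarrow> trunc b m (trunc b n x) = trunc b m x"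
  by (auto simp: trunc_def fun_eq_iff)

lemma range_trunc: "range (trunc b n) = words b n"
  by (auto intro: rev_image_eqI trunc_words[symmetric])

lemma finite_words [simp, intro]: "finite (words b n)"
proof (rule finite_subset)
  show "words b n \<subseteq> (\<lambda>S i. if i < n then i \<in> S else b) ` Pow {..<n}"
  proof
    fix x assume "x \<in> words b n"
    then have "x = (\<lambda>i. if i < n then i \<in> {i. i < n \<and> x i} else b)"
      by (auto simp: words_def fun_eq_iff)
    then show "x \<in> (\<lambda>S i. if i < n then i \<in> S else b) ` Pow {..<n}" by blast
  qed
qed simp

text \<open>Points at distance below \<open>(1/2)^n\<close> share their first \<open>n\<close>
  coordinates. The base 1/2 is an arbitrary choice, since every base in (0,1) induces the same
  topology.\<close>

lemma open_trunc: "open {x. P (trunc b n x)}"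
proof -
  have "\<exists>e>0. \<forall>y. shift_dist (1/2) y x < e \<longrightarrow> P (trunc b n y)" if "P (trunc b n x)" for x
  proof (intro exI[of _ "(1/2)^n"] conjI allI impI)
    fix y assume "shift_dist (1/2) y x < (1/2)^n"
    then have "trunc b n y = trunc b n x"
      using shift_dist_less_iff[of "1/2" y x n] by (simp add: trunc_eq_iff)
    then show "P (trunc b n y)" using that by simp
  qed simp
  then show ?thesis using open_iff_shift_dist[of "1/2" "{x. P (trunc b n x)}"] by simp
qed

text \<open>The \<open>n\<close>-th set consists of the points whose whole \<open>n\<close>-cylinder
  lies in \<open>U\<close>; membership in it depends on the first \<open>n\<close> coordinates
  only.\<close>

lemma open_eq_UN_trunc:
  assumes "open U"
  shows "U = (\<Union>n. {x. \<forall>y. trunc b n y = trunc b n x \<longrightarrow> y \<in> U})"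
proof (intro equalityI subsetI)
  fix x assume "x \<in> U"
  then obtain e where e: "e > 0" "\<And>y. shift_dist (1/2) y x < e \<Longrightarrow> y \<in> U"
    using assms open_iff_shift_dist[of "1/2" U] by auto
  obtain n where n: "(1/2) ^ n < e" using real_arch_pow_inv[OF e(1), of "1/2"] by auto
  have "y \<in> U" if "trunc b n y = trunc b n x" for y
    using that shift_dist_less_iff[of "1/2" y x n] n by (intro e(2)) (simp add: trunc_eq_iff)
  then show "x \<in> (\<Union>n. {x. \<forall>y. trunc b n y = trunc b n x \<longrightarrow> y \<in> U})" by auto
qed auto

text \<open>Open sets are countable unions of sets determined by finitely many coordinates.
  Measurability and approximation can therefore be checked on the latter.\<close>

lemma borel_point_eq_sigma:
  "sets (borel :: point measure) = sigma_sets UNIV {{x. P (trunc b n x)} | P n. True}"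
    (is "_ = sigma_sets UNIV ?G")
proof
  show "sigma_sets UNIV ?G \<subseteq> sets (borel :: point measure)"
    by (rule sets.sigma_sets_subset'[of _ borel, simplified]) (auto intro: open_trunc borel_open)
  have "U \<in> sigma_sets UNIV ?G" if "open U" for U :: "point set"
    by (subst open_eq_UN_trunc[OF that, of b], rule sigma_sets.Union) (auto intro!: sigma_sets.Basic)
  then show "sets (borel :: point measure) \<subseteq> sigma_sets UNIV ?G"
    unfolding borel_def by (auto intro: sigma_sets_mono' simp: sets_measure_of)
       (metis (no_types, lifting) Collect_mono_iff mem_Collect_eq sigma_sets_mono subsetD subsetI)
qed

lemma shift_measurable: "shift \<in> borel \<rightarrow>\<^sub>M borel"
proof (rule measurable_sigma_sets[OF borel_point_eq_sigma[of False]])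
  fix A assume "A \<in> {{x. P (trunc False n x)} | P n. True}"
  then obtain P n where A: "A = {x. P (trunc False n x)}" by auto
  have "trunc False n (shift x) = trunc False n (shift (trunc False (Suc n) x))" for x
    by (simp add: trunc_eq_iff) (simp add: trunc_def shift_def)
  then have "shift -` A = {x. (P \<circ> trunc False n \<circ> shift) (trunc False (Suc n) x)}"
    by (simp add: A)
  then show "shift -` A \<inter> space borel \<in> sets borel"
    using open_trunc[of "P \<circ> trunc False n \<circ> shift" False "Suc n"] by (simp add: borel_open)
qed auto

lemma funpow_shift_measurable: "shift ^^ n \<in> borel \<rightarrow>\<^sub>M borel"
proof (induction n)
  case (Suc n)
  then show ?case unfolding funpow.simps by (rule measurable_comp[OF _ shift_measurable])
qed simp

section \<open>Block entropies of an invariant measure and their rates\<close>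

locale shift_invariant =
  fixes \<nu> :: "point measure"
  assumes invariant: "\<nu> \<in> invariant_probs"
begin

lemma sets_eq [simp]: "sets \<nu> = sets borel"
  using invariant by (simp add: invariant_probs_def)

lemma space_eq [simp]: "space \<nu> = UNIV"
  using sets_eq_imp_space_eq[OF sets_eq] by simp

sublocale prob_space \<nu>
  using invariant by (simp add: invariant_probs_def)

lemma random_variable_funpow_shift: "shift ^^ n \<in> \<nu> \<rightarrow>\<^sub>M borel"
  using funpow_shift_measurable by (simp add: measurable_cong_sets[OF sets_eq refl])

lemma distr_funpow_shift: "distr \<nu> borel (shift ^^ n) = \<nu>"
proof (induction n)
  case 0
  then show ?case by (simp add: distr_id2)
next
  case (Suc n)
  have "distr \<nu> borel (shift ^^ Suc n) = distr (distr \<nu> borel (shift ^^ n)) borel shift"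
    by (subst distr_distr) (auto simp: random_variable_funpow_shift shift_measurable)
  then show ?case using Suc invariant by (simp add: invariant_probs_def comp_def)
qed

lemma integral_funpow_shift:
  fixes g :: "point \<Rightarrow> real"
  assumes "g \<in> borel_measurable borel"
  shows "(\<integral>x. g ((shift ^^ n) x) \<partial>\<nu>) = (\<integral>x. g x \<partial>\<nu>)"
proof -
  have "(\<integral>x. g x \<partial>\<nu>) = (\<integral>x. g x \<partial>distr \<nu> borel (shift ^^ n))" by (simp only: distr_funpow_shift)
  also have "\<dots> = (\<integral>x. g ((shift ^^ n) x) \<partial>\<nu>)" by (intro integral_distr random_variable_funpow_shift assms)
  finally show ?thesis by simp
qed

lemma prob_funpow_shift:
  assumes "A \<in> sets borel"
  shows "prob ((shift ^^ n) -` A) = prob A"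
proof -
  have "prob A = measure (distr \<nu> borel (shift ^^ n)) A" by (simp only: distr_funpow_shift)
  then show ?thesis using assms by (simp add: measure_distr random_variable_funpow_shift)
qed

lemma simple_function_trunc [simp]: "simple_function \<nu> (trunc b n)"
  unfolding simple_function_def
proof (intro conjI ballI)
  show "finite (trunc b n ` space \<nu>)" by (simp add: range_trunc)
  show "trunc b n -` {w} \<inter> space \<nu> \<in> sets \<nu>" for w
    using open_trunc[of "\<lambda>y. y = w" b n] by (simp add: borel_open vimage_def)
qed

lemma simple_function_funpow_shift:
  assumes "simple_function \<nu> Y"
  shows "simple_function \<nu> (\<lambda>x. Y ((shift ^^ n) x))"
proof -
  have "(\<lambda>x. Y ((shift ^^ n) x)) -` {a} = (shift ^^ n) -` (Y -` {a})" for a by auto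
  moreover have "Y -` {a} \<in> sets borel" for a
    using simple_functionD(2)[OF assms, of "{a}"] by simp
  moreover have "range (\<lambda>x. Y ((shift ^^ n) x)) \<subseteq> range Y" by auto
  ultimately show ?thesis
    using assms measurable_sets[OF funpow_shift_measurable, of _ n]
    by (auto simp: simple_function_def intro: finite_subset)
qed

lemma shannon_entropy_funpow_shift:
  assumes Y: "simple_function \<nu> Y"
  shows "shannon_entropy \<nu> (\<lambda>x. Y ((shift ^^ n) x)) = shannon_entropy \<nu> Y"
proof -
  have "Y -` {a} \<in> sets borel" for a
    using simple_functionD(2)[OF Y, of "{a}"] by simp
  then have "prob ((\<lambda>x. Y ((shift ^^ n) x)) -` {a}) = prob (Y -` {a})" for a
    using prob_funpow_shift[of "Y -` {a}" n] by (simp add: vimage_def)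
  moreover have "(\<lambda>x. ln (prob (Y -` {Y x}))) \<in> borel_measurable borel"
    using integrable_simple_image[OF Y, of "\<lambda>a. ln (prob (Y -` {a}))"]
    by (simp add: integrable_iff_bounded measurable_cong_sets[OF sets_eq refl])
  ultimately show ?thesis
    using shannon_entropy_eq[OF Y] shannon_entropy_eq[OF simple_function_funpow_shift[OF Y], of n]
      integral_funpow_shift[of "\<lambda>x. ln (prob (Y -` {Y x}))" n]
    by simp
qed

text \<open>A long block is a function of an initial block and a shifted one, and by invariance the
  shifted one has the entropy of the unshifted one. This serves itineraries and truncated words
  alike.\<close>

lemma subadditive_entropy:
  fixes Y :: "nat \<Rightarrow> point \<Rightarrow> 'b"
  assumes Y: "\<And>n. simple_function \<nu> (Y n)"
    and split: "\<And>x. Y (m + n) x = h (Y m x) (Y n ((shift ^^ m) x))"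
  shows "shannon_entropy \<nu> (Y (m + n)) \<le> shannon_entropy \<nu> (Y m) + shannon_entropy \<nu> (Y n)"
proof -
  let ?Z = "\<lambda>x. Y n ((shift ^^ m) x)"
  have Z: "simple_function \<nu> ?Z" by (rule simple_function_funpow_shift[OF Y])
  have "Y (m + n) = (\<lambda>x. case_prod h (Y m x, ?Z x))" using split by auto
  then have "shannon_entropy \<nu> (Y (m + n)) \<le> shannon_entropy \<nu> (\<lambda>x. (Y m x, ?Z x))"
    using shannon_entropy_compose_le[OF simple_function_Pair[OF Y[of m] Z], of "case_prod h"]
    by (simp only:)
  also have "\<dots> \<le> shannon_entropy \<nu> (Y m) + shannon_entropy \<nu> ?Z"
    by (rule shannon_entropy_Pair_le_add[OF Y Z])
  finally show ?thesis by (simp only: shannon_entropy_funpow_shift[OF Y])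
qed

lemma simple_function_itinerary:
  assumes "simple_function \<nu> \<xi>"
  shows "simple_function \<nu> (itinerary shift \<xi> n)"
proof (induction n)
  case 0
  then show ?case by (simp add: itinerary_def)
next
  case (Suc n)
  have "itinerary shift \<xi> (Suc n) = (\<lambda>x. itinerary shift \<xi> n x @ [\<xi> ((shift ^^ n) x)])"
    by (simp add: itinerary_def fun_eq_iff)
  then show ?case
    using simple_function_compose2[OF Suc simple_function_funpow_shift[OF assms, of n], of "\<lambda>l a. l @ [a]"]
    by simp
qed

definition itinerary_rate :: "(point \<Rightarrow> nat) \<Rightarrow> real" where
  "itinerary_rate \<xi> = (INF n\<in>{1..}. shannon_entropy \<nu> (itinerary shift \<xi> n) / real n)"

lemma itinerary_add:
  "itinerary shift \<xi> (m + n) x = itinerary shift \<xi> m x @ itinerary shift \<xi> n ((shift ^^ m) x)"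
proof (rule nth_equalityI)
  fix i assume "i < length (itinerary shift \<xi> (m + n) x)"
  then show "itinerary shift \<xi> (m + n) x ! i
      = (itinerary shift \<xi> m x @ itinerary shift \<xi> n ((shift ^^ m) x)) ! i"
    by (auto simp: itinerary_def nth_append funpow_shift)
qed (simp add: itinerary_def)

text \<open>Fekete's lemma shows that the \<open>lim\<close> in \<open>partition_entropy\<close> is
  a genuine limit, so inequalities between finite block entropies pass to it.\<close>

lemma partition_entropy_tendsto:
  assumes "simple_function \<nu> \<xi>"
  shows "(\<lambda>n. shannon_entropy \<nu> (itinerary shift \<xi> n) / real n) \<longlonglongrightarrow> partition_entropy \<nu> shift \<xi>"
proof -
  have "(\<lambda>n. shannon_entropy \<nu> (itinerary shift \<xi> n) / real n) \<longlonglongrightarrow> itinerary_rate \<xi>"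
    unfolding itinerary_rate_def
    by (intro subadditive_tendsto_Inf subadditive_entropy[where h = append] simple_function_itinerary
        assms shannon_entropy_nonneg itinerary_add)
  then show ?thesis using limI by (force simp: partition_entropy_def)
qed

text \<open>The entropy rate of the partition by the first coordinate. It turns out to be the
  Kolmogorov-Sinai entropy, whichever filler \<open>b\<close> is used.\<close>

definition word_rate :: "bool \<Rightarrow> real" where
  "word_rate b = (INF n\<in>{1..}. shannon_entropy \<nu> (trunc b n) / real n)"

lemma trunc_add:
  "trunc b (m + n) x = (\<lambda>i. if i < m then trunc b m x i else trunc b n ((shift ^^ m) x) (i - m))"
  by (auto simp: trunc_def funpow_shift fun_eq_iff)

lemma shannon_entropy_trunc_add:
  "shannon_entropy \<nu> (trunc b (m + n)) \<le> shannon_entropy \<nu> (trunc b m) + shannon_entropy \<nu> (trunc b n)"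
  by (intro subadditive_entropy[where h = "\<lambda>u v i. if i < m then u i else v (i - m)"])
     (simp_all add: trunc_add)

lemma word_rate_tendsto: "(\<lambda>n. shannon_entropy \<nu> (trunc b n) / real n) \<longlonglongrightarrow> word_rate b"
  unfolding word_rate_def
  by (intro subadditive_tendsto_Inf shannon_entropy_trunc_add shannon_entropy_nonneg) simp

lemma word_rate_le: "1 \<le> n \<Longrightarrow> word_rate b \<le> shannon_entropy \<nu> (trunc b n) / real n"
  unfolding word_rate_def
  by (intro cINF_lower) (auto intro!: bdd_belowI[of _ 0] divide_nonneg_nonneg shannon_entropy_nonneg)

end

section \<open>The cylinder partition is generating\<close>

context shift_invariant
begin

text \<open>Sets determined by finitely many coordinates form an intersection-stable generator, so
  induction over the generated sigma-algebra applies. For a countable union, finitely many members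
  carry all but \<open>e / 2\<close> of the mass and their approximations are merged at a common
  word length.\<close>

lemma approx_trunc:
  assumes "A \<in> sets borel" "0 < e"
  shows "\<exists>n P. prob (sym_diff A {x. P (trunc b n x)}) < e"
proof -
  let ?G = "{{x. P (trunc b n x)} | P n. True}"
  have meas: "sym_diff A {x. P (trunc b n x)} \<in> sets borel" if "A \<in> sets borel" for A P n
    using that open_trunc[of P b n] by (auto intro: borel_open)
  have stable: "Int_stable ?G"
    unfolding Int_stable_def
  proof safe
    fix P m Q n
    have "{x. P (trunc b m x)} \<inter> {x. Q (trunc b n x)}
        = {x. (\<lambda>z. P (trunc b m z) \<and> Q (trunc b n z)) (trunc b (max m n) x)}"
      by (auto simp: trunc_trunc)
    then show "\<exists>R k. {x. P (trunc b m x)} \<inter> {x. Q (trunc b n x)} = {x. R (trunc b k x)} \<and> True"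
      by (intro exI conjI TrueI)
  qed
  note stable
  moreover have "?G \<subseteq> Pow UNIV" by simp
  moreover have "A \<in> sigma_sets UNIV ?G" using assms(1) by (simp only: borel_point_eq_sigma[of b])
  ultimately have "\<forall>e>0. \<exists>n P. prob (sym_diff A {x. P (trunc b n x)}) < e"
  proof (induction rule: sigma_sets_induct_disjoint)
    case (basic A)
    then obtain P n where "A = {x. P (trunc b n x)}" by auto
    then show ?case by (auto intro!: exI[of _ n] exI[of _ P])
  next
    case empty
    then show ?case by (auto intro!: exI[of _ "\<lambda>_. False"])
  next
    case (compl A)
    have "sym_diff (UNIV - A) {x. (Not \<circ> P) (trunc b n x)} = sym_diff A {x. P (trunc b n x)}" for P n
      by auto
    then show ?case using compl.IH by metis
  next
    case (union A)
    have A: "A i \<in> sets borel" for i using union(2) borel_point_eq_sigma[of b] by auto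
    show ?case
    proof safe
      fix e :: real assume e: "0 < e"
      have "(\<lambda>n. prob (\<Union>i<n. A i)) \<longlonglongrightarrow> prob (\<Union>n. \<Union>i<n. A i)"
        using A by (intro finite_Lim_measure_incseq monoI UN_mono) auto
      moreover have "(\<Union>n. \<Union>i<n. A i) = (\<Union>i. A i)" by auto
      ultimately have "\<forall>\<^sub>F n in sequentially. prob (\<Union>i. A i) - e / 2 < prob (\<Union>i<n. A i)"
        using e by (intro order_tendstoD) auto
      then obtain K where K: "prob (\<Union>i. A i) - e / 2 < prob (\<Union>i<K. A i)"
        by (auto simp: eventually_sequentially)
      \<comment> \<open>The \<open>K\<close> errors add up to at most \<open>e / 2\<close>;
        \<open>Suc K\<close> keeps the denominator positive when \<open>K = 0\<close>.\<close>
      have "\<forall>i. \<exists>n P. prob (sym_diff (A i) {x. P (trunc b n x)}) < e / (2 * real (Suc K))"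
        using union.IH e by simp
      then obtain n P where nP: "\<And>i. prob (sym_diff (A i) {x. P i (trunc b (n i) x)}) < e / (2 * real (Suc K))"
        by metis
      define N where "N = Max (n ` {..<K})"
      have N: "n i \<le> N" if "i < K" for i unfolding N_def using that by auto
      define Q where "Q z \<longleftrightarrow> (\<exists>i<K. P i (trunc b (n i) z))" for z
      let ?D = "\<lambda>i. sym_diff (A i) {x. P i (trunc b (n i) x)}"
      have "sym_diff (\<Union>i. A i) {x. Q (trunc b N x)} \<subseteq> ((\<Union>i. A i) - (\<Union>i<K. A i)) \<union> (\<Union>i<K. ?D i)"
      proof -
        have "Q (trunc b N x) \<longleftrightarrow> (\<exists>i<K. P i (trunc b (n i) x))" for x
          using N by (auto simp: Q_def trunc_trunc)
        then show ?thesis by auto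
      qed
      moreover have D: "?D i \<in> events" for i
        using meas[OF A[of i], of "P i" "n i"] by (simp only: sets_eq)
      moreover have AK: "(\<Union>i. A i) - (\<Union>i<K. A i) \<in> events"
        using A by (intro sets.Diff sets.countable_UN sets.finite_UN) auto
      moreover have DK: "(\<Union>i<K. ?D i) \<in> events"
        using D by (intro sets.finite_UN) auto
      ultimately have "prob (sym_diff (\<Union>i. A i) {x. Q (trunc b N x)})
          \<le> prob (((\<Union>i. A i) - (\<Union>i<K. A i)) \<union> (\<Union>i<K. ?D i))"
        by (intro finite_measure_mono sets.Un)
      also have "\<dots> \<le> prob ((\<Union>i. A i) - (\<Union>i<K. A i)) + prob (\<Union>i<K. ?D i)"
        by (rule measure_Un_le[OF AK DK])
      also have "prob ((\<Union>i. A i) - (\<Union>i<K. A i)) = prob (\<Union>i. A i) - prob (\<Union>i<K. A i)"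
        using A by (intro finite_measure_Diff) auto
      also have "prob (\<Union>i<K. ?D i) \<le> (\<Sum>i<K. prob (?D i))"
        using D by (intro measure_UNION_le) simp_all
      also have "\<dots> \<le> (\<Sum>i<K. e / (2 * real (Suc K)))"
        using nP by (intro sum_mono less_imp_le)
      also have "\<dots> \<le> e / 2" using e by (simp add: field_simps)
      finally have "prob (sym_diff (\<Union>i. A i) {x. Q (trunc b N x)}) < e" using K by simp
      then show "\<exists>n P. prob (sym_diff (\<Union>i. A i) {x. P (trunc b n x)}) < e" by blast
    qed
  qed
  then show ?thesis using assms(2) by blast
qed

text \<open>Each level set is approximated by a set of words. Outside the union of the errors
  exactly one of these word sets contains the word of \<open>x\<close>, namely the one belonging to
  \<open>\<xi> x\<close>.\<close>

lemma approx_simple_function_trunc: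
  fixes \<xi> :: "point \<Rightarrow> 'b"
  assumes \<xi>: "simple_function \<nu> \<xi>" and e: "0 < e"
  shows "\<exists>n \<zeta>. prob {x. \<xi> x \<noteq> \<zeta> (trunc b n x)} < e"
proof -
  have fin: "finite (range \<xi>)" and ms: "\<And>v. \<xi> -` {v} \<in> sets borel"
    using simple_functionD[OF \<xi>] by auto
  let ?r = "card (range \<xi>)"
  have r: "0 < ?r" using fin by (simp add: card_gt_0_iff)
  have "\<forall>v. \<exists>n P. prob (sym_diff (\<xi> -` {v}) {x. P (trunc b n x)}) < e / ?r"
    using approx_trunc[OF ms] e r by simp
  then obtain n P where nP: "\<And>v. prob (sym_diff (\<xi> -` {v}) {x. P v (trunc b (n v) x)}) < e / ?r"
    by metis
  let ?D = "\<lambda>v. sym_diff (\<xi> -` {v}) {x. P v (trunc b (n v) x)}"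
  define N where "N = Max (n ` range \<xi>)"
  have N: "n v \<le> N" if "v \<in> range \<xi>" for v unfolding N_def using that fin by auto
  \<comment> \<open>On words lying in none or in several of the approximating sets the choice is
    arbitrary; such words occur only inside the error set.\<close>
  define \<zeta> where "\<zeta> z = (SOME v. v \<in> range \<xi> \<and> P v (trunc b (n v) z))" for z
  have "{x. \<xi> x \<noteq> \<zeta> (trunc b N x)} \<subseteq> (\<Union>v\<in>range \<xi>. ?D v)"
  proof (rule subsetI, rule ccontr)
    fix x assume x: "x \<in> {x. \<xi> x \<noteq> \<zeta> (trunc b N x)}" "x \<notin> (\<Union>v\<in>range \<xi>. ?D v)"
    have iff: "P v (trunc b (n v) (trunc b N x)) \<longleftrightarrow> v = \<xi> x" if v: "v \<in> range \<xi>" for v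
    proof -
      have "x \<notin> ?D v" using x(2) v by blast
      then show ?thesis unfolding trunc_trunc[OF N[OF v]] by blast
    qed
    have "\<zeta> (trunc b N x) = \<xi> x"
      unfolding \<zeta>_def
    proof (rule some_equality)
      show "\<xi> x \<in> range \<xi> \<and> P (\<xi> x) (trunc b (n (\<xi> x)) (trunc b N x))"
        using iff[of "\<xi> x"] by blast
      show "v = \<xi> x" if "v \<in> range \<xi> \<and> P v (trunc b (n v) (trunc b N x))" for v
        using iff[of v] that by blast
    qed
    then show False using x(1) by simp
  qed
  moreover have D: "?D v \<in> events" for v
    using ms[of v] borel_open[OF open_trunc[of "P v" b "n v"]]
    unfolding sets_eq by (intro sets.Un sets.Diff)
  moreover have "(\<Union>v\<in>range \<xi>. ?D v) \<in> events"
    using D by (intro sets.finite_UN fin) blast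
  ultimately have "prob {x. \<xi> x \<noteq> \<zeta> (trunc b N x)} \<le> prob (\<Union>v\<in>range \<xi>. ?D v)"
    by (intro finite_measure_mono)
  also have "\<dots> \<le> (\<Sum>v\<in>range \<xi>. prob (?D v))"
    using D by (intro measure_UNION_le fin)
  also have "\<dots> < (\<Sum>v\<in>range \<xi>. e / ?r)"
    using fin nP by (intro sum_strict_mono) auto
  also have "\<dots> = e" using r by simp
  finally show ?thesis by blast
qed

text \<open>The conditional law of \<open>\<xi>\<close> given a word is guessed as mass \<open>1 - \<delta>\<close> at \<open>\<zeta>\<close>, the rest spread evenly.\<close>

lemma partition_entropy_le_approx:
  fixes \<xi> :: "point \<Rightarrow> nat"
  assumes \<xi>: "simple_function \<nu> \<xi>"
    and approx: "prob {x. \<xi> x \<noteq> \<zeta> (trunc b m x)} \<le> \<epsilon>" and \<delta>: "0 < \<delta>" "\<delta> < 1"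
  shows "partition_entropy \<nu> shift \<xi>
    \<le> word_rate b - ln (1 - \<delta>) + \<epsilon> * (ln (real (card (range \<xi>))) - ln \<delta>)"
proof -
  let ?r = "real (card (range \<xi>))"
  have fin: "finite (range \<xi>)" using simple_functionD[OF \<xi>] by simp
  have r: "1 \<le> ?r" using fin by (simp add: Suc_le_eq card_gt_0_iff)
  define kern where "kern z v = (if v = \<zeta> z then 1 - \<delta> else \<delta> / ?r)" for z v
  define \<eta> where "\<eta> = - ln (1 - \<delta>) + \<epsilon> * (ln ?r - ln \<delta>)"
  have kern_pos: "0 < kern z v" for z v using \<delta> r by (simp add: kern_def)
  \<comment> \<open>The value \<open>\<zeta> z\<close> may lie outside the range of
    \<open>\<xi>\<close>. Adding \<open>\<delta> / ?r\<close> at every value, also at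
    \<open>\<zeta> z\<close>, still leaves total mass at most 1.\<close>
  have kern_sum: "(\<Sum>v\<in>range \<xi>. kern z v) \<le> 1" for z
  proof -
    have "(\<Sum>v\<in>range \<xi>. kern z v) \<le> (\<Sum>v\<in>range \<xi>. (if v = \<zeta> z then 1 - \<delta> else 0) + \<delta> / ?r)"
      using \<delta> r by (intro sum_mono) (auto simp: kern_def)
    also have "\<dots> \<le> 1 - \<delta> + \<delta>" using fin \<delta> r by (simp add: sum.distrib)
    finally show ?thesis by simp
  qed
  have pair: "simple_function \<nu> (\<lambda>x. (trunc b m x, \<xi> x))" using \<xi> by (intro simple_function_Pair) auto
  have ms: "{x. \<xi> x \<noteq> \<zeta> (trunc b m x)} \<in> sets borel"
    using simple_functionD(2)[OF pair, of "{(z, v). v \<noteq> \<zeta> z}"] by (simp add: vimage_def)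
  have ln_kern: "- \<eta> \<le> (\<integral>x. ln (kern (trunc b m x) (\<xi> x)) \<partial>\<nu>)"
  proof -
    let ?B = "{x. \<xi> x \<noteq> \<zeta> (trunc b m x)}"
    have "(\<integral>x. ln (1 - \<delta>) + indicator ?B x * (ln \<delta> - ln ?r) \<partial>\<nu>)
        \<le> (\<integral>x. ln (kern (trunc b m x) (\<xi> x)) \<partial>\<nu>)"
    proof (rule integral_mono)
      show "integrable \<nu> (\<lambda>x. ln (kern (trunc b m x) (\<xi> x)))"
        using integrable_simple_image[OF pair, of "\<lambda>a. ln (kern (fst a) (snd a))"] by simp
      show "integrable \<nu> (\<lambda>x. ln (1 - \<delta>) + indicator ?B x * (ln \<delta> - ln ?r))"
        using ms by (intro Bochner_Integration.integrable_add integrable_mult_left integrable_real_indicator)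
          (auto simp: emeasure_eq_measure)
      show "ln (1 - \<delta>) + indicator ?B x * (ln \<delta> - ln ?r) \<le> ln (kern (trunc b m x) (\<xi> x))" for x
        using \<delta> r by (auto simp: kern_def ln_div indicator_def)
    qed
    moreover have "(\<integral>x. ln (1 - \<delta>) + indicator ?B x * (ln \<delta> - ln ?r) \<partial>\<nu>)
        = ln (1 - \<delta>) + prob ?B * (ln \<delta> - ln ?r)"
      using ms by (subst Bochner_Integration.integral_add) (auto simp: emeasure_eq_measure prob_space simp del: space_eq)
    moreover have "\<epsilon> * (ln \<delta> - ln ?r) \<le> prob ?B * (ln \<delta> - ln ?r)"
    proof (rule mult_right_mono_neg[OF approx])
      have "ln \<delta> \<le> 0" "0 \<le> ln ?r" using \<delta> r by auto
      then show "ln \<delta> - ln ?r \<le> 0" by linarith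
    qed
    ultimately show ?thesis unfolding \<eta>_def by (simp add: right_diff_distrib)
  qed
  \<comment> \<open>Each further itinerary symbol costs at most \<open>\<eta>\<close>: for
    \<open>j < n\<close> the \<open>m\<close>-word seen at time \<open>j\<close> is contained in the
    word of length \<open>n + m\<close>, so the kernel can be read off from it.\<close>
  have joint: "shannon_entropy \<nu> (\<lambda>x. (trunc b (n + m) x, itinerary shift \<xi> j x))
      \<le> shannon_entropy \<nu> (trunc b (n + m)) + j * \<eta>" if "j \<le> n" for n j
    using that
  proof (induction j)
    case 0
    have "shannon_entropy \<nu> (\<lambda>x. (trunc b (n + m) x, itinerary shift \<xi> 0 x)) \<le> shannon_entropy \<nu> (trunc b (n + m))"
      using shannon_entropy_compose_le[OF simple_function_trunc[of b "n + m"], where h = "\<lambda>z. (z, [] :: nat list)"]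
      by (simp add: itinerary_def)
    then show ?case by simp
  next
    case (Suc j)
    let ?X = "\<lambda>x. (trunc b (n + m) x, itinerary shift \<xi> j x)"
    let ?Y = "\<lambda>x. \<xi> ((shift ^^ j) x)"
    let ?k = "\<lambda>a v. kern (trunc b m ((shift ^^ j) (fst a))) v"
    have X: "simple_function \<nu> ?X" by (intro simple_function_Pair simple_function_itinerary \<xi>) simp
    have Y: "simple_function \<nu> ?Y" by (rule simple_function_funpow_shift[OF \<xi>])
    have "shannon_entropy \<nu> (\<lambda>x. (trunc b (n + m) x, itinerary shift \<xi> (Suc j) x))
        \<le> shannon_entropy \<nu> (\<lambda>x. (?X x, ?Y x))"
      using shannon_entropy_compose_le[OF simple_function_Pair[OF X Y], where h = "\<lambda>((z, l), v). (z, l @ [v])"]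
      by (simp add: itinerary_def)
    also have "\<dots> \<le> shannon_entropy \<nu> ?X - (\<integral>x. ln (?k (?X x) (?Y x)) \<partial>\<nu>)"
    proof (rule shannon_entropy_Pair_le[OF X Y])
      show "0 \<le> ?k a v" for a v by (rule less_imp_le[OF kern_pos])
      show "0 < ?k (?X x) (?Y x)" for x by (rule kern_pos)
      have "(\<Sum>v\<in>?Y ` space \<nu>. ?k a v) \<le> (\<Sum>v\<in>range \<xi>. ?k a v)" for a
        using fin kern_pos by (intro sum_mono2) (auto intro: less_imp_le)
      then show "(\<Sum>v\<in>?Y ` space \<nu>. ?k a v) \<le> 1" for a using kern_sum order_trans by blast
    qed
    finally have step: "shannon_entropy \<nu> (\<lambda>x. (trunc b (n + m) x, itinerary shift \<xi> (Suc j) x))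
        \<le> shannon_entropy \<nu> ?X - (\<integral>x. ln (?k (?X x) (?Y x)) \<partial>\<nu>)" .
    have "(\<integral>x. ln (?k (?X x) (?Y x)) \<partial>\<nu>)
        = (\<integral>x. ln (kern (trunc b m ((shift ^^ j) x)) (\<xi> ((shift ^^ j) x))) \<partial>\<nu>)"
    proof -
      have "trunc b m ((shift ^^ j) (trunc b (n + m) x)) = trunc b m ((shift ^^ j) x)" for x
        using Suc.prems by (auto simp: trunc_eq_iff funpow_shift trunc_def)
      then show ?thesis by simp
    qed
    also have "\<dots> = (\<integral>x. ln (kern (trunc b m x) (\<xi> x)) \<partial>\<nu>)"
      using integrable_simple_image[OF pair, of "\<lambda>a. ln (kern (fst a) (snd a))"]
      by (intro integral_funpow_shift) (simp add: integrable_iff_bounded measurable_cong_sets[OF sets_eq refl])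
    finally have "(\<integral>x. ln (?k (?X x) (?Y x)) \<partial>\<nu>) = (\<integral>x. ln (kern (trunc b m x) (\<xi> x)) \<partial>\<nu>)" .
    moreover have "shannon_entropy \<nu> ?X \<le> shannon_entropy \<nu> (trunc b (n + m)) + j * \<eta>"
      using Suc by simp
    moreover have "real (Suc j) * \<eta> = j * \<eta> + \<eta>" by (simp add: distrib_right)
    ultimately show ?case using step ln_kern by linarith
  qed
  \<comment> \<open>The \<open>m\<close> surplus coordinates cost the entropy of one fixed word
    length, which vanishes after division by \<open>n\<close>.\<close>
  have le: "shannon_entropy \<nu> (itinerary shift \<xi> n) / real n
      \<le> shannon_entropy \<nu> (trunc b n) / real n + shannon_entropy \<nu> (trunc b m) / real n + \<eta>"
    if "1 \<le> n" for n
  proof -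
    have "shannon_entropy \<nu> (itinerary shift \<xi> n)
        \<le> shannon_entropy \<nu> (\<lambda>x. (trunc b (n + m) x, itinerary shift \<xi> n x))"
      using shannon_entropy_compose_le[of "\<lambda>x. (trunc b (n + m) x, itinerary shift \<xi> n x)" snd]
        simple_function_itinerary[OF \<xi>] by (simp add: simple_function_Pair)
    also have "\<dots> \<le> shannon_entropy \<nu> (trunc b n) + shannon_entropy \<nu> (trunc b m) + n * \<eta>"
      using joint[of n n] shannon_entropy_trunc_add[of b n m] by simp
    finally show ?thesis using that by (simp add: field_simps)
  qed
  have "(\<lambda>n. shannon_entropy \<nu> (trunc b n) / real n + shannon_entropy \<nu> (trunc b m) / real n + \<eta>)
      \<longlonglongrightarrow> word_rate b + 0 + \<eta>"
    by (intro tendsto_add word_rate_tendsto tendsto_const lim_const_over_n)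
  then have "partition_entropy \<nu> shift \<xi> \<le> word_rate b + 0 + \<eta>"
    using LIMSEQ_le[OF partition_entropy_tendsto[OF \<xi>]] le by blast
  then show ?thesis by (simp add: \<eta>_def)
qed

lemma partition_entropy_le:
  assumes \<xi>: "simple_function \<nu> \<xi>"
  shows "partition_entropy \<nu> shift \<xi> \<le> word_rate b"
proof (rule field_le_epsilon)
  fix e :: real assume e: "0 < e"
  \<comment> \<open>With \<open>\<delta>\<close> fixed first, \<open>- ln (1 - \<delta>)\<close>
    takes half of \<open>e\<close>; the word length is then chosen so that the misprediction term
    takes the other half.\<close>
  define \<delta> where "\<delta> = 1 - exp (- (e / 2))"
  have \<delta>: "0 < \<delta>" "\<delta> < 1" "- ln (1 - \<delta>) = e / 2" using e by (auto simp: \<delta>_def)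
  let ?r = "real (card (range \<xi>))"
  have "1 \<le> ?r" using simple_functionD[OF \<xi>] by (simp add: Suc_le_eq card_gt_0_iff)
  then have "0 \<le> ln ?r" "ln \<delta> < 0" using \<delta> by auto
  then have l: "0 < ln ?r - ln \<delta>" by linarith
  obtain m \<zeta> where m: "prob {x. \<xi> x \<noteq> \<zeta> (trunc b m x)} < (e / 2) / (ln ?r - ln \<delta>)"
    using approx_simple_function_trunc[OF \<xi>, of "(e / 2) / (ln ?r - ln \<delta>)" b] e l by auto
  have mult_div: "x / y * y = x" if "0 < y" for x y :: real using that by simp
  have "partition_entropy \<nu> shift \<xi> \<le> word_rate b - ln (1 - \<delta>) + (e / 2) / (ln ?r - ln \<delta>) * (ln ?r - ln \<delta>)"
    by (rule partition_entropy_le_approx[OF \<xi> less_imp_le[OF m] \<delta>(1,2)])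
  also have "(e / 2) / (ln ?r - ln \<delta>) * (ln ?r - ln \<delta>) = e / 2" by (rule mult_div[OF l])
  finally show "partition_entropy \<nu> shift \<xi> \<le> word_rate b + e" using \<delta>(3) by linarith
qed

text \<open>The generator theorem for the partition by the first coordinate. Every partition is
  nearly a function of long words, which gives the upper bound; the itineraries of the first
  coordinate determine the words, which gives the lower one.\<close>

theorem ks_entropy_eq_word_rate: "ks_entropy \<nu> shift = ereal (word_rate b)"
  unfolding ks_entropy_def
proof (intro antisym SUP_least)
  fix \<xi> :: "point \<Rightarrow> nat" assume "\<xi> \<in> {\<xi>. simple_function \<nu> \<xi>}"
  then show "ereal (partition_entropy \<nu> shift \<xi>) \<le> ereal (word_rate b)"
    using partition_entropy_le by simp
next
  define \<xi> :: "point \<Rightarrow> nat" where "\<xi> x = of_bool (x 0)" for x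
  have "\<xi> = (\<lambda>x. of_bool (trunc b 1 x 0))" by (auto simp: \<xi>_def trunc_def)
  then have \<xi>: "simple_function \<nu> \<xi>"
    using simple_function_compose1[OF simple_function_trunc[of b 1], where g = "\<lambda>x. of_bool (x 0) :: nat"] by simp
  have "trunc b n = (\<lambda>x. (\<lambda>l i. if i < n then l ! i = 1 else b) (itinerary shift \<xi> n x))" for n
    by (auto simp: trunc_def itinerary_def \<xi>_def funpow_shift fun_eq_iff)
  then have "shannon_entropy \<nu> (trunc b n) \<le> shannon_entropy \<nu> (itinerary shift \<xi> n)" for n
    using shannon_entropy_compose_le[OF simple_function_itinerary[OF \<xi>, of n],
        where h = "\<lambda>l i. if i < n then l ! i = 1 else b"] by simp
  then have "word_rate b \<le> partition_entropy \<nu> shift \<xi>"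
    using LIMSEQ_le[OF word_rate_tendsto[of b] partition_entropy_tendsto[OF \<xi>]]
    by (auto simp: divide_right_mono)
  then show "ereal (word_rate b) \<le> (SUP \<xi>\<in>{\<xi>. simple_function \<nu> \<xi>}. ereal (partition_entropy \<nu> shift \<xi>))"
    using \<xi> by (intro SUP_upper2[of \<xi>]) auto
qed

end

section \<open>Partition functions of potentials with bounded distortion\<close>

lemma birkhoff_sum_add:
  "birkhoff_sum g (m + n) x = birkhoff_sum g m x + birkhoff_sum g n ((shift ^^ m) x)"
  by (induction n) (simp_all add: birkhoff_sum_def funpow_shift add.assoc)

lemma birkhoff_sum_mult:
  "birkhoff_sum g (k * n) x = (\<Sum>j<k. birkhoff_sum g n ((shift ^^ (j * n)) x))"
  by (induction k) (simp_all add: birkhoff_sum_add add.commute[of n], simp add: birkhoff_sum_def)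

lemma funpow_shift_const: "(shift ^^ n) (\<lambda>_. b) = (\<lambda>_. b)"
  by (simp add: funpow_shift)

lemma birkhoff_sum_const: "birkhoff_sum g n (\<lambda>_. b) = real n * g (\<lambda>_. b)"
  by (simp add: birkhoff_sum_def funpow_shift_const)

lemma words_0: "words b 0 = {\<lambda>_. b}"
  by (auto simp: words_def)

text \<open>In the expanded product, the \<open>j\<close>-th summand collects the choices whose last
  chosen factor is \<open>s j\<close>.\<close>

lemma prod_one_plus_eq:
  fixes s :: "nat \<Rightarrow> 'a :: comm_semiring_1"
  shows "(\<Prod>j<n. 1 + s j) = 1 + (\<Sum>j<n. s j * (\<Prod>i<j. 1 + s i))"
  by (induction n) (simp_all add: algebra_simps)

text \<open>A discrete Gronwall inequality: \<open>A * (1 + \<kappa>) ^ n\<close> satisfies the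
  recursion with equality.\<close>

lemma renewal_bound:
  fixes G :: "nat \<Rightarrow> real"
  assumes "0 \<le> \<kappa>" and rec: "\<And>n. G n \<le> A + \<kappa> * (\<Sum>j<n. G j)"
  shows "G n \<le> A * (1 + \<kappa>) ^ n"
proof (induction n rule: less_induct)
  case (less n)
  have sum: "\<kappa> * (\<Sum>j<n. (1 + \<kappa>) ^ j) = (1 + \<kappa>) ^ n - 1"
    using geometric_sum[of "1 + \<kappa>" n] by (cases "\<kappa> = 0") auto
  have "G n \<le> A + \<kappa> * (\<Sum>j<n. A * (1 + \<kappa>) ^ j)"
    using rec[of n] less assms(1) by (smt (verit) lessThan_iff mult_left_mono sum_mono)
  also have "\<dots> = A + A * (\<kappa> * (\<Sum>j<n. (1 + \<kappa>) ^ j))"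
    by (simp add: sum_distrib_left mult_ac)
  also have "\<dots> = A * (1 + \<kappa>) ^ n" by (simp add: sum algebra_simps)
  finally show ?case .
qed

text \<open>Bounded distortion is the only regularity that the counting arguments use. The symbol
  \<open>b\<close> is both the filler of words and the letter of the constant blocks under study.
  Non-negativity allows incomplete blocks to be dropped from Birkhoff sums.\<close>

locale potential =
  fixes g :: "point \<Rightarrow> real" and D :: real and b :: bool
  assumes measurable_potential: "g \<in> borel_measurable borel"
    and bounded_potential: "\<exists>B. \<forall>x. \<bar>g x\<bar> \<le> B"
    and nonneg_potential: "\<And>x. 0 \<le> g x"
    and distortion: "\<And>n x y. \<forall>i<n. x i = y i \<Longrightarrow> birkhoff_sum g n x \<le> birkhoff_sum g n y + D"
begin

lemma distortion_trunc:
  "birkhoff_sum g n x \<le> birkhoff_sum g n (trunc b n x) + D"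
  "birkhoff_sum g n (trunc b n x) \<le> birkhoff_sum g n x + D"
  by (auto intro!: distortion simp: trunc_def)

lemma D_nonneg: "0 \<le> D"
  using distortion[of 0 undefined undefined] by simp

definition partition_function :: "nat \<Rightarrow> real" where
  "partition_function n = (\<Sum>w\<in>words b n. exp (birkhoff_sum g n w))"

lemma words_nonempty: "words b n \<noteq> {}"
  using trunc_in_words by blast

lemma partition_function_pos: "0 < partition_function n"
  unfolding partition_function_def by (intro sum_pos) (auto simp: words_nonempty)

section \<open>Words weighted by their aligned constant blocks\<close>

definition const_block :: "nat \<Rightarrow> nat \<Rightarrow> point \<Rightarrow> bool" where
  "const_block m j x \<longleftrightarrow> (\<forall>i<m. x (j * m + i) = b)"

text \<open>This is 2 to the number of constant blocks, hence the number of ways to mark some of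
  them. Its logarithm is additive over blocks, so its mean is a multiple of the probability of the
  constant word.\<close>

definition block_weight :: "nat \<Rightarrow> nat \<Rightarrow> point \<Rightarrow> real" where
  "block_weight m n x = (\<Prod>j<n. 1 + of_bool (const_block m j x))"

definition weighted_partition_function :: "nat \<Rightarrow> nat \<Rightarrow> real" where
  "weighted_partition_function m n =
     (\<Sum>w\<in>words b (n * m). exp (birkhoff_sum g (n * m) w) * block_weight m n w)"

lemma block_weight_eq:
  "block_weight m n x = 1 + (\<Sum>j<n. of_bool (const_block m j x) * block_weight m j x)"
  unfolding block_weight_def by (rule prod_one_plus_eq)

lemma block_weight_pos: "0 < block_weight m n x"
  unfolding block_weight_def by (intro prod_pos) (auto simp: of_bool_def)

lemma const_block_trunc:
  assumes "j < n" shows "const_block m j (trunc b (n * m) x) = const_block m j x"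
proof -
  have "j * m + i < n * m" if "i < m" for i
  proof -
    have "j * m + i < Suc j * m" using that by simp
    also have "\<dots> \<le> n * m" using assms by (intro mult_le_mono1) simp
    finally show ?thesis .
  qed
  then show ?thesis by (simp add: const_block_def trunc_def)
qed

lemma block_weight_trunc: "block_weight m n (trunc b (n * m) x) = block_weight m n x"
  unfolding block_weight_def by (intro prod.cong) (simp_all add: const_block_trunc)

lemma weighted_partition_function_pos: "0 < weighted_partition_function m n"
  unfolding weighted_partition_function_def
  by (intro sum_pos) (auto simp: words_nonempty block_weight_pos)

text \<open>Cutting a word at the constant block \<open>j\<close> leaves a weighted prefix and a
  free suffix, and the Birkhoff sum splits accordingly. One \<open>D\<close> pays for truncating the
  prefix, the other for comparing the block with the fixed point.\<close>

lemma marked_sum_le: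
  assumes "j < n"
  shows "(\<Sum>w\<in>words b (n * m). exp (birkhoff_sum g (n * m) w) * (of_bool (const_block m j w) * block_weight m j w))
    \<le> weighted_partition_function m j * exp (m * g (\<lambda>_. b) + 2 * D) * partition_function ((n - Suc j) * m)"
proof -
  let ?r = "(n - Suc j) * m"
  let ?W = "{w \<in> words b (n * m). const_block m j w}"
  let ?\<phi> = "\<lambda>w. (trunc b (j * m) w, (shift ^^ (Suc j * m)) w)"
  let ?h = "\<lambda>(u, v). (exp (birkhoff_sum g (j * m) u) * block_weight m j u) * exp (m * g (\<lambda>_. b) + 2 * D)
      * exp (birkhoff_sum g ?r v)"
  have nm: "n * m = j * m + m + ?r"
    using assms by (metis Suc_leI add.commute le_add_diff_inverse mult_Suc add_mult_distrib)
  \<comment> \<open>The removed middle block consists of \<open>b\<close> alone, so prefix and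
    suffix determine the word.\<close>
  have inj: "inj_on ?\<phi> ?W"
  proof (rule inj_onI, rule ext)
    fix x y i assume xy: "x \<in> ?W" "y \<in> ?W" "?\<phi> x = ?\<phi> y"
    consider "i < j * m" | "j * m \<le> i" "i < Suc j * m" | "Suc j * m \<le> i" by linarith
    then show "x i = y i"
    proof cases
      case 1
      then show ?thesis using xy(3) by (simp add: trunc_eq_iff)
    next
      case 2
      then have "i - j * m < m" "j * m + (i - j * m) = i" by auto
      then show ?thesis using xy(1,2) unfolding const_block_def by (metis (mono_tags, lifting) mem_Collect_eq)
    next
      case 3
      have "x (Suc j * m + (i - Suc j * m)) = y (Suc j * m + (i - Suc j * m))"
        using xy(3) unfolding funpow_shift prod.inject fun_eq_iff by blast
      then show ?thesis using 3 by simp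
    qed
  qed
  \<comment> \<open>The filler beyond \<open>n * m\<close> survives the shift, so the suffix is
    itself a word and costs no distortion.\<close>
  have image: "?\<phi> ` ?W \<subseteq> words b (j * m) \<times> words b ?r"
  proof safe
    fix w assume "w \<in> words b (n * m)"
    then show "(shift ^^ (Suc j * m)) w \<in> words b ?r"
      using nm by (auto simp: words_def funpow_shift)
  qed simp
  have bound: "exp (birkhoff_sum g (n * m) w) * block_weight m j w \<le> ?h (?\<phi> w)" if w: "w \<in> ?W" for w
  proof -
    have "birkhoff_sum g (n * m) w = birkhoff_sum g (j * m) w + birkhoff_sum g m ((shift ^^ (j * m)) w)
        + birkhoff_sum g ?r ((shift ^^ (Suc j * m)) w)"
      unfolding nm birkhoff_sum_add by (simp add: add.commute[of "j * m" m])
    moreover have "birkhoff_sum g m ((shift ^^ (j * m)) w) \<le> m * g (\<lambda>_. b) + D"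
      using distortion[of m "(shift ^^ (j * m)) w" "\<lambda>_. b"] w
      by (simp add: birkhoff_sum_const const_block_def funpow_shift)
    ultimately have "birkhoff_sum g (n * m) w \<le> birkhoff_sum g (j * m) (trunc b (j * m) w)
        + (m * g (\<lambda>_. b) + 2 * D) + birkhoff_sum g ?r ((shift ^^ (Suc j * m)) w)"
      using distortion_trunc(1)[of "j * m" w] by linarith
    then have "exp (birkhoff_sum g (n * m) w) \<le> exp (birkhoff_sum g (j * m) (trunc b (j * m) w))
        * exp (m * g (\<lambda>_. b) + 2 * D) * exp (birkhoff_sum g ?r ((shift ^^ (Suc j * m)) w))"
      by (simp flip: exp_add)
    from mult_right_mono[OF this less_imp_le[OF block_weight_pos[of m j w]]]
    show ?thesis by (simp add: block_weight_trunc mult_ac)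
  qed
  have "(\<Sum>w\<in>words b (n * m). exp (birkhoff_sum g (n * m) w) * (of_bool (const_block m j w) * block_weight m j w))
      = (\<Sum>w\<in>?W. exp (birkhoff_sum g (n * m) w) * block_weight m j w)"
    by (rule sum.mono_neutral_cong_right) auto
  also have "\<dots> \<le> (\<Sum>w\<in>?W. ?h (?\<phi> w))" by (intro sum_mono bound)
  also have "\<dots> = (\<Sum>a\<in>?\<phi> ` ?W. ?h a)" by (rule sum.reindex[OF inj, of ?h, unfolded comp_def, symmetric])
  also have "\<dots> \<le> (\<Sum>a\<in>words b (j * m) \<times> words b ?r. ?h a)"
    using image by (intro sum_mono2) (auto intro!: mult_nonneg_nonneg less_imp_le[OF block_weight_pos])
  also have "\<dots> = weighted_partition_function m j * exp (m * g (\<lambda>_. b) + 2 * D) * partition_function ?r"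
    unfolding weighted_partition_function_def partition_function_def
    by (simp add: sum.cartesian_product[symmetric] sum_distrib_right) (simp add: sum_distrib_left)
  finally show ?thesis .
qed

text \<open>Sorting the markings of a word by their last marked block yields a renewal inequality
  for the normalised sums \<open>G\<close>; the empty marking contributes the inhomogeneous term
  \<open>exp D\<close>.\<close>

lemma weighted_partition_function_le:
  assumes P: "\<And>n. partition_function n \<le> exp (n * P + D)"
  shows "weighted_partition_function m n
    \<le> exp (D + real (n * m) * P) * (1 + exp (m * (g (\<lambda>_. b) - P) + 3 * D)) ^ n"
proof -
  \<comment> \<open>Two of the three \<open>D\<close> come from cutting at the marked block, the
    third from the bound on the partition function of the suffix.\<close>
  define \<kappa> where "\<kappa> = exp (m * (g (\<lambda>_. b) - P) + 3 * D)"
  define G where "G n = weighted_partition_function m n * exp (- (real (n * m) * P))" for n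
  have "G n \<le> exp D + \<kappa> * (\<Sum>j<n. G j)" for n
  proof -
    have "weighted_partition_function m n = partition_function (n * m) + (\<Sum>j<n. \<Sum>w\<in>words b (n * m).
        exp (birkhoff_sum g (n * m) w) * (of_bool (const_block m j w) * block_weight m j w))"
      unfolding weighted_partition_function_def partition_function_def
      by (subst sum.swap, subst block_weight_eq) (simp only: distrib_left mult_1_right sum.distrib sum_distrib_left)
    also have "\<dots> \<le> exp (real (n * m) * P + D)
        + (\<Sum>j<n. weighted_partition_function m j * exp (m * g (\<lambda>_. b) + 2 * D) * exp (real ((n - Suc j) * m) * P + D))"
      by (intro add_mono sum_mono order.trans[OF marked_sum_le] mult_left_mono P mult_nonneg_nonneg
          less_imp_le[OF weighted_partition_function_pos]) simp_all
    also have "\<dots> = exp (real (n * m) * P) * (exp D + \<kappa> * (\<Sum>j<n. G j))"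
    proof -
      have "weighted_partition_function m j * exp (m * g (\<lambda>_. b) + 2 * D) * exp (real ((n - Suc j) * m) * P + D)
          = exp (real (n * m) * P) * (\<kappa> * G j)" if "j < n" for j
      proof -
        have "real (n - Suc j) = real n - 1 - real j" using that by (simp add: of_nat_diff)
        then have r: "real ((n - Suc j) * m) = real (n * m) - real m - real (j * m)"
          by (simp add: left_diff_distrib)
        have "(m * g (\<lambda>_. b) + 2 * D) + (real ((n - Suc j) * m) * P + D)
            = real (n * m) * P + (m * (g (\<lambda>_. b) - P) + 3 * D) + - (real (j * m) * P)"
          unfolding r by (simp add: algebra_simps)
        then have "exp (m * g (\<lambda>_. b) + 2 * D) * exp (real ((n - Suc j) * m) * P + D)
            = exp (real (n * m) * P) * \<kappa> * exp (- (real (j * m) * P))"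
          unfolding \<kappa>_def exp_add[symmetric] by (rule arg_cong)
        then have "weighted_partition_function m j * (exp (m * g (\<lambda>_. b) + 2 * D) * exp (real ((n - Suc j) * m) * P + D))
            = weighted_partition_function m j * (exp (real (n * m) * P) * \<kappa> * exp (- (real (j * m) * P)))"
          by (rule arg_cong)
        then show ?thesis by (simp only: G_def mult_ac)
      qed
      then have "(\<Sum>j<n. weighted_partition_function m j * exp (m * g (\<lambda>_. b) + 2 * D) * exp (real ((n - Suc j) * m) * P + D))
          = (\<Sum>j<n. exp (real (n * m) * P) * (\<kappa> * G j))" by (intro sum.cong) auto
      then show ?thesis unfolding exp_add distrib_left sum_distrib_left by (simp only:)
    qed
    finally have "weighted_partition_function m n * exp (- (real (n * m) * P))
        \<le> (exp (real (n * m) * P) * (exp D + \<kappa> * (\<Sum>j<n. G j))) * exp (- (real (n * m) * P))"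
      by (intro mult_right_mono) auto
    also have "\<dots> = exp D + \<kappa> * (\<Sum>j<n. G j)" by (simp add: exp_minus)
    finally show ?thesis by (simp add: G_def)
  qed
  then have "G n \<le> exp D * (1 + \<kappa>) ^ n" by (intro renewal_bound) (auto simp: \<kappa>_def)
  then have "G n * exp (real (n * m) * P) \<le> exp D * (1 + \<kappa>) ^ n * exp (real (n * m) * P)"
    by (intro mult_right_mono) auto
  moreover have "G n * exp (real (n * m) * P) = weighted_partition_function m n"
    by (simp add: G_def exp_minus)
  ultimately show ?thesis
    unfolding exp_add[of D "real (n * m) * P"] \<kappa>_def[symmetric] by (simp only: mult_ac)
qed

end

section \<open>Gibbs' inequality along an invariant measure\<close>

locale invariant_potential = shift_invariant \<nu> + potential g D b for \<nu> g D b
begin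

lemma integrable_potential_shift: "integrable \<nu> (\<lambda>x. g ((shift ^^ n) x))"
proof -
  obtain B where "\<And>x. \<bar>g x\<bar> \<le> B" using bounded_potential by blast
  then show ?thesis
    using measurable_compose[OF random_variable_funpow_shift measurable_potential]
    by (intro integrable_const_bound[of _ B]) (auto simp: measurable_cong_sets[OF sets_eq refl])
qed

lemma integral_birkhoff_sum: "(\<integral>x. birkhoff_sum g n x \<partial>\<nu>) = n * (\<integral>x. g x \<partial>\<nu>)"
  unfolding birkhoff_sum_def
  by (subst Bochner_Integration.integral_sum)
    (simp_all add: integrable_potential_shift integral_funpow_shift[OF measurable_potential])

lemma integrable_birkhoff_sum: "integrable \<nu> (birkhoff_sum g n)"
  unfolding birkhoff_sum_def[abs_def] by (intro Bochner_Integration.integrable_sum integrable_potential_shift)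

lemma integrable_birkhoff_sum_trunc: "integrable \<nu> (\<lambda>x. birkhoff_sum g n (trunc b n x))"
  using integrable_simple_image[OF simple_function_trunc, of "birkhoff_sum g n"] .

lemma integral_birkhoff_sum_trunc:
  "n * (\<integral>x. g x \<partial>\<nu>) - D \<le> (\<integral>x. birkhoff_sum g n (trunc b n x) \<partial>\<nu>)"
  "(\<integral>x. birkhoff_sum g n (trunc b n x) \<partial>\<nu>) \<le> n * (\<integral>x. g x \<partial>\<nu>) + D"
proof -
  have "(\<integral>x. birkhoff_sum g n x - D \<partial>\<nu>) \<le> (\<integral>x. birkhoff_sum g n (trunc b n x) \<partial>\<nu>)"
    by (intro integral_mono integrable_birkhoff_sum_trunc Bochner_Integration.integrable_diff
        integrable_birkhoff_sum) (use distortion_trunc(1) in \<open>auto simp: diff_le_eq\<close>)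
  then show "n * (\<integral>x. g x \<partial>\<nu>) - D \<le> (\<integral>x. birkhoff_sum g n (trunc b n x) \<partial>\<nu>)"
    by (simp add: Bochner_Integration.integral_diff integrable_birkhoff_sum integral_birkhoff_sum prob_space[simplified])
  have "(\<integral>x. birkhoff_sum g n (trunc b n x) \<partial>\<nu>) \<le> (\<integral>x. birkhoff_sum g n x + D \<partial>\<nu>)"
    by (intro integral_mono integrable_birkhoff_sum_trunc Bochner_Integration.integrable_add
        integrable_birkhoff_sum) (use distortion_trunc(2) in auto)
  then show "(\<integral>x. birkhoff_sum g n (trunc b n x) \<partial>\<nu>) \<le> n * (\<integral>x. g x \<partial>\<nu>) + D"
    by (simp add: Bochner_Integration.integral_add integrable_birkhoff_sum integral_birkhoff_sum prob_space[simplified])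
qed

text \<open>The logarithm is \<open>ln 2\<close> times the number of constant blocks, and by
  invariance each of the \<open>n\<close> positions contributes the same probability.\<close>

lemma integral_ln_block_weight:
  "(\<integral>x. ln (block_weight m n x) \<partial>\<nu>) = n * (ln 2 * prob {x. \<forall>i<m. x i = b})"
proof -
  let ?A = "{x. \<forall>i<m. x i = b}"
  have A: "?A \<in> sets borel"
    using borel_open[OF open_trunc[of "\<lambda>z. \<forall>i<m. z i = b" b m]] by (simp add: trunc_def)
  define h :: "point \<Rightarrow> real" where "h x = ln 2 * indicator ?A x" for x
  have h: "h \<in> borel_measurable borel" unfolding h_def[abs_def] using A by simp
  have h_shift: "(\<lambda>x. h ((shift ^^ k) x)) \<in> borel_measurable \<nu>" for k
    by (rule measurable_compose[OF random_variable_funpow_shift h])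
  have bound: "norm (h x) \<le> ln 2" for x by (simp add: h_def indicator_def)
  have "ln (block_weight m n x) = (\<Sum>j<n. h ((shift ^^ (j * m)) x))" for x
    unfolding block_weight_def h_def
    by (subst ln_prod) (auto intro!: sum.cong simp: const_block_def funpow_shift of_bool_def indicator_def)
  then have "(\<integral>x. ln (block_weight m n x) \<partial>\<nu>) = (\<integral>x. (\<Sum>j<n. h ((shift ^^ (j * m)) x)) \<partial>\<nu>)"
    by presburger
  also have "\<dots> = (\<Sum>j<n. \<integral>x. h ((shift ^^ (j * m)) x) \<partial>\<nu>)"
    by (rule Bochner_Integration.integral_sum) (rule integrable_const_bound[OF AE_I2[OF bound] h_shift])
  also have "\<dots> = n * (\<integral>x. h x \<partial>\<nu>)"
    by (simp add: integral_funpow_shift[OF h])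
  also have "(\<integral>x. h x \<partial>\<nu>) = ln 2 * prob ?A" unfolding h_def using A by simp
  finally show ?thesis .
qed

text \<open>Gibbs' inequality on words of length \<open>n * m\<close> with the doubled weights. The
  rate is the infimum of normalised block entropies, and \<open>D\<close> pays for evaluating
  Birkhoff sums at words.\<close>

lemma word_rate_potential_le:
  assumes m: "1 \<le> m"
  shows "real (n * m) * (word_rate b + (\<integral>x. g x \<partial>\<nu>)) + n * (ln 2 * prob {x. \<forall>i<m. x i = b})
    \<le> ln (weighted_partition_function m n) + D"
proof (cases "n = 0")
  case True
  then show ?thesis using D_nonneg
    by (simp add: weighted_partition_function_def block_weight_def words_0 birkhoff_sum_def)
next
  case False
  let ?N = "n * m"
  let ?q = "\<lambda>w. exp (birkhoff_sum g ?N w) * block_weight m n w"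
  have N: "1 \<le> ?N" using False m by simp
  have "shannon_entropy \<nu> (trunc b ?N) + (\<integral>x. ln (?q (trunc b ?N x)) \<partial>\<nu>)
      \<le> ln (weighted_partition_function m n)"
    by (rule gibbs_inequality[OF simple_function_trunc])
      (auto simp: range_trunc weighted_partition_function_def block_weight_pos intro!: mult_nonneg_nonneg less_imp_le[OF block_weight_pos])
  moreover have "(\<integral>x. ln (?q (trunc b ?N x)) \<partial>\<nu>)
      = (\<integral>x. birkhoff_sum g ?N (trunc b ?N x) \<partial>\<nu>) + (\<integral>x. ln (block_weight m n x) \<partial>\<nu>)"
  proof -
    have "ln (?q (trunc b ?N x)) = birkhoff_sum g ?N (trunc b ?N x) + ln (block_weight m n x)" for x
      using block_weight_pos[of m n x] by (simp add: ln_mult block_weight_trunc)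
    moreover have "integrable \<nu> (\<lambda>x. ln (block_weight m n x))"
      using integrable_simple_image[OF simple_function_trunc[of b ?N], of "\<lambda>w. ln (block_weight m n w)"]
      by (simp add: block_weight_trunc)
    ultimately show ?thesis
      using integrable_birkhoff_sum_trunc by (simp add: Bochner_Integration.integral_add)
  qed
  moreover have "?N * word_rate b \<le> shannon_entropy \<nu> (trunc b ?N)"
    using word_rate_le[OF N, of b] N by (simp add: field_simps)
  ultimately show ?thesis
    using integral_birkhoff_sum_trunc(1)[of ?N] by (simp add: integral_ln_block_weight distrib_left)
qed

text \<open>For a measure attaining \<open>P\<close>, the terms \<open>n * m * P\<close> in the
  lower and the upper bound for the logarithm of the weighted sum cancel. What remains compares
  \<open>ln 2\<close> times the probability with \<open>ln (1 + \<kappa>)\<close>.\<close>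

lemma prob_const_word_le:
  fixes m :: nat
  assumes P: "\<And>n. partition_function n \<le> exp (n * P + D)"
    and eq: "word_rate b + (\<integral>x. g x \<partial>\<nu>) = P" and m: "1 \<le> m"
  shows "prob {x. \<forall>i<m. x i = b} \<le> 2 * exp (m * (g (\<lambda>_. b) - P) + 3 * D)"
proof -
  let ?p = "prob {x. \<forall>i<m. x i = b}"
  define \<kappa> where "\<kappa> = exp (m * (g (\<lambda>_. b) - P) + 3 * D)"
  have \<kappa>: "0 < \<kappa>" by (simp add: \<kappa>_def)
  have le: "n * (ln 2 * ?p - ln (1 + \<kappa>)) \<le> 2 * D" for n :: nat
  proof -
    have "ln (weighted_partition_function m n) \<le> ln (exp (D + real (n * m) * P) * (1 + \<kappa>) ^ n)"
      using weighted_partition_function_le[OF P, of m n] weighted_partition_function_pos[of m n]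
      by (simp add: \<kappa>_def)
    also have "\<dots> = D + real (n * m) * P + n * ln (1 + \<kappa>)"
      using \<kappa> by (simp add: ln_mult ln_realpow)
    finally show ?thesis using word_rate_potential_le[OF m, of n] unfolding eq
      by (simp add: right_diff_distrib)
  qed
  \<comment> \<open>By \<open>le\<close>, all multiples of this number stay below the fixed bound
    \<open>2 * D\<close>.\<close>
  have "ln 2 * ?p - ln (1 + \<kappa>) \<le> 0"
  proof (rule ccontr)
    assume "\<not> ?thesis"
    then obtain n :: nat where "2 * D < n * (ln 2 * ?p - ln (1 + \<kappa>))"
      using ex_less_of_nat_mult[of "ln 2 * ?p - ln (1 + \<kappa>)" "2 * D"] by auto
    then show False using le[of n] by simp
  qed
  then have "ln 2 * ?p \<le> \<kappa>" using ln_add_one_self_le_self[of \<kappa>] \<kappa> by linarith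
  \<comment> \<open>The inequality \<open>1 / 2 \<le> ln 2\<close> is
    \<open>ln t \<le> t - 1\<close> at \<open>t = 1 / 2\<close>; it produces the factor 2.\<close>
  moreover have "1 / 2 * ?p \<le> ln 2 * ?p"
    using ln_le_minus_one[of "1 / 2"] by (intro mult_right_mono) (auto simp: ln_div)
  ultimately show ?thesis by (simp add: \<kappa>_def)
qed

end

section \<open>Block measures and the pressure\<close>

lemma measurable_point:
  assumes "\<And>i. (\<lambda>\<omega>. X \<omega> i) \<in> measurable M (count_space UNIV)"
  shows "X \<in> M \<rightarrow>\<^sub>M (borel :: point measure)"
proof (rule measurable_sigma_sets[OF borel_point_eq_sigma[of False]])
  fix A assume "A \<in> {{x. P (trunc False n x)} | P n. True}"
  then obtain P n where A: "A = {x. P (trunc False n x)}" by auto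
  have "X -` A \<inter> space M = (\<Union>w\<in>{w \<in> words False n. P w}. {\<omega> \<in> space M. trunc False n (X \<omega>) = w})"
    by (auto simp: A)
  also have "\<dots> = (\<Union>w\<in>{w \<in> words False n. P w}. {\<omega> \<in> space M. \<forall>i\<in>{..<n}. X \<omega> i = w i})"
    by (intro SUP_cong refl) (auto simp: trunc_words[symmetric] trunc_def words_def fun_eq_iff)
  also have "\<dots> \<in> sets M"
  proof (rule sets.finite_UN)
    show "finite {w \<in> words False n. P w}" by simp
    fix w
    have "{\<omega> \<in> space M. X \<omega> i = w i} \<in> sets M" for i
      using measurable_sets[OF assms[of i], of "{w i}"] by (simp add: vimage_def Int_def conj_commute)
    then show "{\<omega> \<in> space M. \<forall>i\<in>{..<n}. X \<omega> i = w i} \<in> sets M"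
      by (intro sets.sets_Collect_finite_All) auto
  qed
  finally show "X -` A \<inter> space M \<in> sets M" .
qed auto

lemma sets_trunc_iterates:
  fixes k :: nat
  shows "{x. \<forall>j<k. trunc b n ((shift ^^ t j) x) = z j} \<in> sets (borel :: point measure)"
proof -
  have "{x \<in> space borel. trunc b n ((shift ^^ m) x) = w} \<in> sets (borel :: point measure)" for m w
    using measurable_sets[OF funpow_shift_measurable[of m] borel_open[OF open_trunc[of "\<lambda>v. v = w" b n]]]
    by (simp add: vimage_def)
  then have "{x \<in> space borel. \<forall>j\<in>{..<k}. trunc b n ((shift ^^ t j) x) = z j} \<in> sets (borel :: point measure)"
    by (intro sets.sets_Collect_finite_All) auto
  then show ?thesis by (simp only: space_borel UNIV_I simp_thms Ball_def lessThan_iff)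
qed

text \<open>The shift moves each phase to the next, and phase \<open>N\<close> has the law of phase
  0, so the average over \<open>N\<close> phases is invariant.\<close>

lemma phase_average_invariant:
  fixes \<rho> :: "point measure"
  assumes "prob_space \<rho>" and sets: "sets \<rho> = sets borel"
    and inv: "distr \<rho> borel (shift ^^ N) = \<rho>" and N: "1 \<le> N"
  obtains \<nu> where "\<nu> \<in> invariant_probs"
    and "\<And>A. A \<in> sets borel \<Longrightarrow> measure \<nu> A = (\<Sum>i<N. measure \<rho> ((shift ^^ i) -` A)) / N"
proof -
  interpret prob_space \<rho> by fact
  have space: "space \<rho> = UNIV" using sets_eq_imp_space_eq[OF sets] by simp
  have iter: "shift ^^ i \<in> \<rho> \<rightarrow>\<^sub>M borel" for i
    using funpow_shift_measurable[of i] by (simp add: measurable_cong_sets[OF sets refl])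
  define K where "K i = distr \<rho> borel (shift ^^ i)" for i
  have prob_K: "prob_space (K i)" for i unfolding K_def by (rule prob_space_distr[OF iter])
  have sets_K: "sets (K i) = sets borel" for i by (simp add: K_def)
  \<comment> \<open>A mixture: the phase is drawn uniformly and \<open>\<rho>\<close> is pushed
    forward by that many shifts.\<close>
  define \<nu> where "\<nu> = measure_pmf (pmf_of_set {..<N}) \<bind> K"
  have K: "K \<in> measure_pmf (pmf_of_set {..<N}) \<rightarrow>\<^sub>M subprob_algebra borel"
    using prob_K sets_K by (auto simp: space_subprob_algebra prob_space_imp_subprob_space)
  have prob_\<nu>: "prob_space \<nu>"
    unfolding \<nu>_def by (intro measure_pmf.prob_space_bind[OF _ K] AE_I2 prob_K)
  interpret \<nu>: prob_space \<nu> by (rule prob_\<nu>)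
  have sets_\<nu>: "sets \<nu> = sets borel" unfolding \<nu>_def by (intro sets_bind) (auto simp: sets_K)
  have measure_\<nu>: "measure \<nu> A = (\<Sum>i<N. measure \<rho> ((shift ^^ i) -` A)) / N" if A: "A \<in> sets borel" for A
  proof -
    have "measure \<nu> A = (\<integral>i. measure (K i) A \<partial>measure_pmf (pmf_of_set {..<N}))"
      unfolding \<nu>_def by (rule measure_pmf.measure_bind[OF K A])
    also have "\<dots> = (\<Sum>i<N. measure (K i) A) / N"
      using N by (subst integral_pmf_of_set) (simp_all add: lessThan_empty_iff)
    also have "(\<Sum>i<N. measure (K i) A) = (\<Sum>i<N. measure \<rho> ((shift ^^ i) -` A))"
      using A by (simp add: K_def measure_distr[OF iter] space)
    finally show ?thesis .
  qed
  have shift: "shift \<in> \<nu> \<rightarrow>\<^sub>M borel"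
    using shift_measurable by (simp add: measurable_cong_sets[OF sets_\<nu> refl])
  have "distr \<nu> borel shift = \<nu>"
  proof (rule measure_eqI)
    fix A assume "A \<in> sets (distr \<nu> borel shift)"
    then have A: "A \<in> sets borel" by simp
    then have A': "shift -` A \<in> sets borel" using measurable_sets[OF shift_measurable A] by simp
    let ?e = "\<lambda>i. measure \<rho> ((shift ^^ i) -` A)"
    have "?e N = measure (distr \<rho> borel (shift ^^ N)) A"
      using A by (simp add: measure_distr[OF iter] space)
    then have eN: "?e N = ?e 0" by (simp add: inv)
    have "measure \<nu> (shift -` A) = (\<Sum>i<N. ?e (Suc i)) / N"
      unfolding measure_\<nu>[OF A'] by (simp add: vimage_comp funpow_swap1 comp_def)
    also have "(\<Sum>i<N. ?e (Suc i)) = (\<Sum>i<N. ?e i)"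
      using eN sum.lessThan_Suc_shift[of ?e N] by simp
    also have "\<dots> / N = measure \<nu> A" by (simp add: measure_\<nu>[OF A])
    finally have "measure \<nu> (shift -` A) = measure \<nu> A" .
    moreover have "space \<nu> = UNIV" using sets_eq_imp_space_eq[OF sets_\<nu>] by simp
    ultimately show "emeasure (distr \<nu> borel shift) A = emeasure \<nu> A"
      using A by (simp add: emeasure_distr[OF shift] \<nu>.emeasure_eq_measure)
  qed (simp add: sets_\<nu>)
  then have "\<nu> \<in> invariant_probs" using prob_\<nu> sets_\<nu> by (simp add: invariant_probs_def)
  then show ?thesis using measure_\<nu> that by blast
qed

text \<open>Independent samples of \<open>q\<close> are concatenated, each contributing its first
  \<open>N\<close> coordinates. Shifting by \<open>N\<close> deletes one sample, which leaves the
  law unchanged.\<close>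

lemma block_process:
  fixes q :: "point pmf"
  assumes N: "1 \<le> N"
  obtains \<rho> :: "point measure" where "prob_space \<rho>" "sets \<rho> = sets borel"
    "distr \<rho> borel (shift ^^ N) = \<rho>"
    "\<And>k z. measure \<rho> {x. \<forall>j<k. trunc b N ((shift ^^ (j * N)) x) = z j}
      = (\<Prod>j<k. measure q {y. trunc b N y = z j})"
proof -
  let ?B = "PiM UNIV (\<lambda>_::nat. measure_pmf q)"
  interpret B: product_prob_space "\<lambda>_::nat. measure_pmf q" UNIV
    by standard
  have space_B: "space ?B = UNIV" by (simp add: space_PiM)
  define \<Phi> :: "(nat \<Rightarrow> point) \<Rightarrow> point" where "\<Phi> y = (\<lambda>i. y (i div N) (i mod N))" for y
  have \<Phi>: "\<Phi> \<in> ?B \<rightarrow>\<^sub>M borel"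
  proof (rule measurable_point)
    fix i
    have "(\<lambda>y. y (i div N)) \<in> ?B \<rightarrow>\<^sub>M measure_pmf q" by (rule measurable_component_singleton) simp
    then show "(\<lambda>y. \<Phi> y i) \<in> ?B \<rightarrow>\<^sub>M count_space UNIV"
      unfolding \<Phi>_def by (rule measurable_compose) simp
  qed
  have \<Phi>_shift: "(shift ^^ (j * N)) (\<Phi> y) = \<Phi> (\<lambda>i. y (j + i))" for j y
    using N by (auto simp: \<Phi>_def funpow_shift fun_eq_iff)
  have trunc_\<Phi>: "trunc b N (\<Phi> y) = trunc b N (y 0)" for y
    by (simp add: \<Phi>_def trunc_def fun_eq_iff)
  have suc: "(\<lambda>y i. y (Suc i)) \<in> ?B \<rightarrow>\<^sub>M ?B"
    by (rule measurable_PiM_single') (auto intro!: measurable_component_singleton simp: space_PiM)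
  \<comment> \<open>The factors are identical, so reindexing along the injective \<open>Suc\<close>
    reproduces the product measure.\<close>
  have distr_suc: "distr ?B ?B (\<lambda>y i. y (Suc i)) = ?B"
    using distr_PiM_reindex[of UNIV "\<lambda>_. measure_pmf q" Suc UNIV, OF measure_pmf.prob_space_axioms]
    by (simp add: restrict_UNIV)
  define \<rho> where "\<rho> = distr ?B borel \<Phi>"
  show thesis
  proof (rule that[of \<rho>])
    show "prob_space \<rho>" unfolding \<rho>_def by (rule B.prob_space_distr[OF \<Phi>])
    show "sets \<rho> = sets borel" by (simp add: \<rho>_def)
    have "distr \<rho> borel (shift ^^ N) = distr ?B borel (\<lambda>y. \<Phi> (\<lambda>i. y (Suc i)))"
      unfolding \<rho>_def using \<Phi>_shift[of 1]
      by (subst distr_distr[OF funpow_shift_measurable \<Phi>]) (simp add: comp_def)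
    also have "\<dots> = distr (distr ?B ?B (\<lambda>y i. y (Suc i))) borel \<Phi>"
      by (subst distr_distr[OF \<Phi> suc]) (simp add: comp_def)
    also have "\<dots> = \<rho>" by (simp add: distr_suc \<rho>_def)
    finally show "distr \<rho> borel (shift ^^ N) = \<rho>" .
    fix k z
    let ?A = "{x. \<forall>j<k. trunc b N ((shift ^^ (j * N)) x) = z j}"
    have A: "?A \<in> sets borel" by (rule sets_trunc_iterates)
    have "\<Phi> -` ?A = {y. \<forall>j<k. trunc b N (y j) = z j}"
      unfolding vimage_def mem_Collect_eq \<Phi>_shift trunc_\<Phi> add_0_right ..
    then have "emeasure \<rho> ?A = emeasure ?B {y \<in> space ?B. \<forall>j\<in>{..<k}. y j \<in> {y. trunc b N y = z j}}"
      by (simp add: \<rho>_def emeasure_distr[OF \<Phi> A] space_B Ball_def)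
    also have "\<dots> = (\<Prod>j\<in>{..<k}. emeasure q {y. trunc b N y = z j})"
      by (rule B.emeasure_PiM_Collect) auto
    finally show "measure \<rho> ?A = (\<Prod>j<k. measure q {y. trunc b N y = z j})"
      by (simp add: measure_def[of \<rho>] measure_pmf.emeasure_eq_measure prod_ennreal prod_nonneg)
  qed
qed

section \<open>The block measure of a potential\<close>

context potential
begin

definition word_pmf :: "nat \<Rightarrow> point pmf" where
  "word_pmf N = embed_pmf (\<lambda>w. if w \<in> words b N then exp (birkhoff_sum g N w) / partition_function N else 0)"

lemma pmf_word_pmf:
  "pmf (word_pmf N) w = (if w \<in> words b N then exp (birkhoff_sum g N w) / partition_function N else 0)"
  unfolding word_pmf_def
proof (rule pmf_embed_pmf)
  let ?f = "\<lambda>w. if w \<in> words b N then exp (birkhoff_sum g N w) / partition_function N else 0"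
  show "0 \<le> ?f w" for w using partition_function_pos[of N] by simp
  have "(\<integral>\<^sup>+w. ennreal (?f w) \<partial>count_space UNIV) = (\<Sum>w\<in>words b N. ennreal (?f w))"
    by (rule nn_integral_count_space'[OF finite_words]) auto
  also have "\<dots> = ennreal (\<Sum>w\<in>words b N. exp (birkhoff_sum g N w) / partition_function N)"
    using partition_function_pos[of N] by (simp add: sum_ennreal)
  also have "(\<Sum>w\<in>words b N. exp (birkhoff_sum g N w) / partition_function N) = 1"
    using partition_function_pos[of N] by (simp add: partition_function_def flip: sum_divide_distrib)
  finally show "(\<integral>\<^sup>+w. ennreal (?f w) \<partial>count_space UNIV) = 1" by simp
qed

text \<open>The law lives on words, so only the word of \<open>x\<close> itself is charged in this
  cylinder. One \<open>D\<close> replaces that word by the arbitrary point \<open>x\<close>.\<close>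

lemma measure_word_pmf_trunc:
  "measure (word_pmf N) {y. trunc b N y = trunc b N x}
    \<le> exp (birkhoff_sum g N x + D - ln (partition_function N))"
proof -
  have "{y. trunc b N y = trunc b N x} \<inter> set_pmf (word_pmf N) \<subseteq> {trunc b N x}"
    by (auto simp: set_pmf_iff pmf_word_pmf trunc_words split: if_splits)
  then have "measure (word_pmf N) {y. trunc b N y = trunc b N x} \<le> measure (word_pmf N) {trunc b N x}"
    by (subst measure_Int_set_pmf[symmetric]) (intro measure_pmf.finite_measure_mono, auto)
  also have "\<dots> = exp (birkhoff_sum g N (trunc b N x)) / partition_function N"
    by (simp add: measure_pmf_single pmf_word_pmf)
  also have "\<dots> = exp (birkhoff_sum g N (trunc b N x) - ln (partition_function N))"
    using partition_function_pos[of N] by (simp add: exp_diff)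
  also have "\<dots> \<le> exp (birkhoff_sum g N x + D - ln (partition_function N))"
    using distortion_trunc(2)[of N x] by simp
  finally show ?thesis .
qed

lemma birkhoff_sum_nonneg: "0 \<le> birkhoff_sum g n x"
  unfolding birkhoff_sum_def by (intro sum_nonneg nonneg_potential)

text \<open>Dropping the incomplete blocks at both ends uses that the potential is non-negative.\<close>

lemma exists_invariant_gibbs:
  assumes N: "1 \<le> N"
  obtains \<nu> where "\<nu> \<in> invariant_probs"
    and "\<And>k x. measure \<nu> {y. trunc b (Suc k * N) y = trunc b (Suc k * N) x}
      \<le> exp (birkhoff_sum g (Suc k * N) x + k * (D - ln (partition_function N)))"
proof -
  obtain \<rho> :: "point measure" where \<rho>: "prob_space \<rho>" "sets \<rho> = sets borel" "distr \<rho> borel (shift ^^ N) = \<rho>"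
    and \<rho>_eq: "\<And>k z. measure \<rho> {x. \<forall>j<k. trunc b N ((shift ^^ (j * N)) x) = z j}
      = (\<Prod>j<k. measure (word_pmf N) {y. trunc b N y = z j})"
    using block_process[OF N, where q = "word_pmf N" and b = b] by blast
  interpret \<rho>: prob_space \<rho> by fact
  obtain \<nu> where \<nu>: "\<nu> \<in> invariant_probs"
    and \<nu>_eq: "\<And>A. A \<in> sets borel \<Longrightarrow> measure \<nu> A = (\<Sum>i<N. measure \<rho> ((shift ^^ i) -` A)) / N"
    using phase_average_invariant[OF \<rho> N] by blast
  show thesis
  proof (rule that[OF \<nu>])
    fix k x
    let ?n = "Suc k * N"
    let ?A = "{y. trunc b ?n y = trunc b ?n x}"
    let ?bound = "exp (birkhoff_sum g ?n x + k * (D - ln (partition_function N)))"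
    have "measure \<rho> ((shift ^^ i) -` ?A) \<le> ?bound" if i: "i < N" for i
    proof -
      \<comment> \<open>If the \<open>i\<close>-th shift of \<open>y\<close> follows
        \<open>x\<close>, the block boundary at coordinate \<open>N\<close> of \<open>y\<close> sits
        at coordinate \<open>N - i\<close> of \<open>x\<close>. From there \<open>k\<close> complete
        blocks fit into the first \<open>Suc k * N\<close> coordinates of \<open>x\<close>.\<close>
      let ?x = "\<lambda>j. (shift ^^ (j * N)) ((shift ^^ (N - i)) x)"
      let ?C = "{y. \<forall>j<k. trunc b N ((shift ^^ (j * N)) y) = trunc b N (?x j)}"
      have C_sets: "?C \<in> sets borel" by (rule sets_trunc_iterates)
      have sub: "(shift ^^ i) -` ?A \<subseteq> (shift ^^ N) -` ?C"
      proof (intro subsetI vimageI2 CollectI allI impI)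
        fix y j assume "y \<in> (shift ^^ i) -` ?A" and j: "j < k"
        then have y: "trunc b ?n ((shift ^^ i) y) = trunc b ?n x" by blast
        have "y (N + (j * N + r)) = x (N - i + (j * N + r))" if r: "r < N" for r
        proof -
          have "Suc j * N \<le> k * N" using j by (intro mult_le_mono1) simp
          then have "N - i + (j * N + r) < ?n" using r i by simp
          then have "y (i + (N - i + (j * N + r))) = x (N - i + (j * N + r))"
            using y by (simp add: trunc_eq_iff funpow_shift)
          moreover have "i + (N - i + (j * N + r)) = N + (j * N + r)" using i by simp
          ultimately show ?thesis by simp
        qed
        then show "trunc b N ((shift ^^ (j * N)) ((shift ^^ N) y)) = trunc b N (?x j)"
          by (simp add: trunc_eq_iff funpow_shift add.assoc)
      qed
      have "(shift ^^ N) -` ?C \<in> sets \<rho>"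
        using measurable_sets[OF funpow_shift_measurable[of N] C_sets]
        unfolding space_borel Int_UNIV_right \<rho>(2) .
      then have "measure \<rho> ((shift ^^ i) -` ?A) \<le> measure \<rho> ((shift ^^ N) -` ?C)"
        by (rule \<rho>.finite_measure_mono[OF sub])
      also have "\<dots> = measure (distr \<rho> borel (shift ^^ N)) ?C"
      proof -
        have "shift ^^ N \<in> \<rho> \<rightarrow>\<^sub>M borel"
          using funpow_shift_measurable[of N] by (simp add: measurable_cong_sets[OF \<rho>(2) refl])
        moreover have "space \<rho> = UNIV" using sets_eq_imp_space_eq[OF \<rho>(2)] by simp
        ultimately show ?thesis using measure_distr[OF _ C_sets, of "shift ^^ N" \<rho>] by simp
      qed
      also have "\<dots> = (\<Prod>j<k. measure (word_pmf N) {y. trunc b N y = trunc b N (?x j)})"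
        unfolding \<rho>(3) by (rule \<rho>_eq)
      also have "\<dots> \<le> (\<Prod>j<k. exp (birkhoff_sum g N (?x j) + D - ln (partition_function N)))"
        by (intro prod_mono conjI measure_nonneg measure_word_pmf_trunc)
      also have "\<dots> = exp (birkhoff_sum g (k * N) ((shift ^^ (N - i)) x) + k * (D - ln (partition_function N)))"
        by (simp add: birkhoff_sum_mult sum.distrib sum_subtractf right_diff_distrib flip: exp_sum)
      also have "birkhoff_sum g (k * N) ((shift ^^ (N - i)) x) \<le> birkhoff_sum g ?n x"
      proof -
        have "?n = (N - i) + k * N + i" using i by simp
        then have "birkhoff_sum g ?n x = birkhoff_sum g (N - i) x
            + birkhoff_sum g (k * N) ((shift ^^ (N - i)) x) + birkhoff_sum g i ((shift ^^ ((N - i) + k * N)) x)"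
          by (simp only: birkhoff_sum_add)
        then show ?thesis
          using birkhoff_sum_nonneg[of "N - i" x] birkhoff_sum_nonneg[of i "(shift ^^ ((N - i) + k * N)) x"]
          by linarith
      qed
      finally show ?thesis by simp
    qed
    then have "(\<Sum>i<N. measure \<rho> ((shift ^^ i) -` ?A)) \<le> (\<Sum>i<N. ?bound)"
      by (intro sum_mono) auto
    then have "(\<Sum>i<N. measure \<rho> ((shift ^^ i) -` ?A)) / N \<le> ?bound"
      using N by (simp add: divide_le_eq mult.commute)
    then show "measure \<nu> ?A \<le> ?bound"
      using \<nu>_eq borel_open[OF open_trunc[of "\<lambda>z. z = trunc b ?n x" b ?n]] by simp
  qed
qed

end

context invariant_potential
begin

text \<open>Upper bounds on cylinder masses are lower bounds on the information function.
  Integration bounds the entropy of words of length \<open>Suc k * N\<close> from below, and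
  \<open>k\<close> tends to infinity after division by that length.\<close>

lemma word_rate_potential_ge:
  assumes N: "1 \<le> N"
    and gibbs: "\<And>k x. prob {y. trunc b (Suc k * N) y = trunc b (Suc k * N) x}
      \<le> exp (birkhoff_sum g (Suc k * N) x + k * (D - Q))"
  shows "(Q - D) / N \<le> word_rate b + (\<integral>x. g x \<partial>\<nu>)"
proof -
  let ?I = "\<integral>x. g x \<partial>\<nu>"
  have le: "k * (Q - D) - Suc k * N * ?I \<le> shannon_entropy \<nu> (trunc b (Suc k * N))" for k :: nat
  proof -
    let ?n = "Suc k * N"
    have "(\<integral>x. ln (prob {y. trunc b ?n y = trunc b ?n x}) \<partial>\<nu>)
        \<le> (\<integral>x. birkhoff_sum g ?n x + k * (D - Q) \<partial>\<nu>)"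
    proof (rule integral_mono_AE)
      show "integrable \<nu> (\<lambda>x. ln (prob {y. trunc b ?n y = trunc b ?n x}))"
        using integrable_simple_image[OF simple_function_trunc, of "\<lambda>w. ln (prob {y. trunc b ?n y = w})" b ?n] .
      show "integrable \<nu> (\<lambda>x. birkhoff_sum g ?n x + k * (D - Q))"
        by (intro Bochner_Integration.integrable_add integrable_birkhoff_sum) simp
      show "AE x in \<nu>. ln (prob {y. trunc b ?n y = trunc b ?n x}) \<le> birkhoff_sum g ?n x + k * (D - Q)"
        using AE_simple_image_pos[OF simple_function_trunc[of b ?n]]
      proof eventually_elim
        case (elim x)
        then have "0 < prob {y. trunc b ?n y = trunc b ?n x}" by (simp add: vimage_def)
        then have "ln (prob {y. trunc b ?n y = trunc b ?n x}) \<le> ln (exp (birkhoff_sum g ?n x + k * (D - Q)))"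
          using gibbs[of k x] by (intro ln_mono) auto
        then show ?case by simp
      qed
    qed
    also have "\<dots> = ?n * ?I + k * (D - Q)"
      by (simp add: Bochner_Integration.integral_add integrable_birkhoff_sum integral_birkhoff_sum prob_space[simplified] del: mult_Suc of_nat_mult)
    finally show ?thesis
      by (simp add: shannon_entropy_eq vimage_def algebra_simps)
  qed
  \<comment> \<open>Only \<open>k\<close> of \<open>Suc k\<close> blocks are controlled; the missing
    one disappears since the quotient tends to 1.\<close>
  have "(\<lambda>k. real k / real (Suc k) * ((Q - D) / N) - ?I) \<longlonglongrightarrow> 1 * ((Q - D) / N) - ?I"
    by (intro tendsto_intros LIMSEQ_n_over_Suc_n)
  moreover have "(\<lambda>k. shannon_entropy \<nu> (trunc b (Suc k * N)) / real (Suc k * N)) \<longlonglongrightarrow> word_rate b"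
  proof -
    have "strict_mono (\<lambda>k. Suc k * N)" using N by (intro strict_monoI mult_strict_right_mono) auto
    from LIMSEQ_subseq_LIMSEQ[OF word_rate_tendsto this] show ?thesis by (simp add: comp_def)
  qed
  moreover have "real k / real (Suc k) * ((Q - D) / N) - ?I
      \<le> shannon_entropy \<nu> (trunc b (Suc k * N)) / real (Suc k * N)" for k
  proof -
    have eq: "u / v * (q / w) - c = (u * q - v * w * c) / (v * w)" if "0 < v" "0 < w" for c q u v w :: real
      using that by (simp add: field_simps)
    have "real k / real (Suc k) * ((Q - D) / N) - ?I = (k * (Q - D) - Suc k * N * ?I) / real (Suc k * N)"
      using N unfolding of_nat_mult by (intro eq) auto
    also have "\<dots> \<le> shannon_entropy \<nu> (trunc b (Suc k * N)) / real (Suc k * N)"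
      by (intro divide_right_mono le) simp
    finally show ?thesis .
  qed
  ultimately have "1 * ((Q - D) / N) - ?I \<le> word_rate b" by (intro LIMSEQ_le) auto
  then show ?thesis by simp
qed

end

text \<open>The block measure of length \<open>n\<close> competes in the supremum defining the
  pressure, and its entropy plus integral is at least
  \<open>(ln (partition_function n) - D) / n\<close>.\<close>

lemma (in potential) partition_function_le_pressure:
  assumes P: "pressure g = ereal P"
  shows "partition_function n \<le> exp (n * P + D)"
proof (cases "n = 0")
  case True
  then show ?thesis using D_nonneg by (simp add: partition_function_def words_0 birkhoff_sum_def)
next
  case False
  then have n: "1 \<le> n" by simp
  obtain \<nu> where \<nu>: "\<nu> \<in> invariant_probs"
    and gibbs: "\<And>k x. measure \<nu> {y. trunc b (Suc k * n) y = trunc b (Suc k * n) x}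
      \<le> exp (birkhoff_sum g (Suc k * n) x + k * (D - ln (partition_function n)))"
    using exists_invariant_gibbs[OF n] by blast
  interpret invariant_potential \<nu> g D b
    using \<nu> by unfold_locales
  have "ks_entropy \<nu> shift + ereal (integral\<^sup>L \<nu> g) \<le> ereal P"
    unfolding P[symmetric] pressure_def by (rule SUP_upper[OF \<nu>])
  then have "word_rate b + (\<integral>x. g x \<partial>\<nu>) \<le> P" by (simp add: ks_entropy_eq_word_rate[of b])
  then have "(ln (partition_function n) - D) / n \<le> P"
    using word_rate_potential_ge[OF n gibbs] by simp
  then have "ln (partition_function n) \<le> n * P + D"
    using n by (simp add: divide_le_eq mult.commute)
  then show ?thesis using partition_function_pos[of n] by (metis exp_le_cancel_iff exp_ln)
qed

section \<open>Lipschitz potentials\<close>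

lemma shift_dist_le_1:
  assumes "0 < \<theta>" "\<theta> < 1"
  shows "shift_dist \<theta> x y \<le> 1"
  using assms power_le_one[of \<theta>] by (auto simp: shift_dist_def simp del: power_Suc)

lemma lipschitz_shiftE:
  assumes "lipschitz_shift \<theta> f" "0 < \<theta>"
  obtains L where "0 \<le> L" "\<And>x y. \<bar>f x - f y\<bar> \<le> L * shift_dist \<theta> x y"
proof -
  obtain L where L: "\<And>x y. \<bar>f x - f y\<bar> \<le> L * shift_dist \<theta> x y"
    using assms by (auto simp: lipschitz_shift_def)
  have "0 \<le> shift_dist \<theta> x y" for x y using assms by (simp add: shift_dist_def)
  then have "L * shift_dist \<theta> x y \<le> \<bar>L\<bar> * shift_dist \<theta> x y" for x y
    by (intro mult_right_mono) auto
  then show ?thesis using L order.trans by (intro that[of "\<bar>L\<bar>"]) (simp, blast)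
qed

lemma lipschitz_shift_measurable:
  assumes f: "lipschitz_shift \<theta> f" and \<theta>: "0 < \<theta>" "\<theta> < 1"
  shows "f \<in> borel_measurable borel"
proof (rule borel_measurableI)
  fix S :: "real set" assume S: "open S"
  obtain L where L: "0 \<le> L" "\<And>x y. \<bar>f x - f y\<bar> \<le> L * shift_dist \<theta> x y"
    using lipschitz_shiftE[OF f \<theta>(1)] by blast
  have "open (f -` S)"
  proof (subst open_iff_shift_dist[OF \<theta>], intro ballI)
    fix x assume "x \<in> f -` S"
    then obtain e where e: "0 < e" "\<And>t. \<bar>t - f x\<bar> < e \<Longrightarrow> t \<in> S"
      using S by (auto simp: open_dist dist_real_def)
    \<comment> \<open>The \<open>L + 1\<close> keeps the radius positive when
      \<open>L = 0\<close>.\<close>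
    have "y \<in> f -` S" if "shift_dist \<theta> y x < e / (L + 1)" for y
    proof -
      have "0 \<le> shift_dist \<theta> y x" using \<theta> by (simp add: shift_dist_def)
      then have "\<bar>f y - f x\<bar> \<le> (L + 1) * shift_dist \<theta> y x"
        using L(2)[of y x] by (simp add: distrib_right)
      also have "\<dots> < e" using that L(1) by (simp add: pos_less_divide_eq mult.commute)
      finally show ?thesis using e(2) by simp
    qed
    then show "\<exists>e>0. \<forall>y. shift_dist \<theta> y x < e \<longrightarrow> y \<in> f -` S"
      using e(1) L(1) by (intro exI[of _ "e / (L + 1)"]) auto
  qed
  then show "f -` S \<inter> space borel \<in> sets borel" by (simp add: borel_open)
qed

lemma lipschitz_shift_bounded:
  assumes f: "lipschitz_shift \<theta> f" and \<theta>: "0 < \<theta>" "\<theta> < 1"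
  shows "\<exists>B. \<forall>x. \<bar>f x\<bar> \<le> B"
proof -
  obtain L where L: "0 \<le> L" "\<And>x y. \<bar>f x - f y\<bar> \<le> L * shift_dist \<theta> x y"
    using lipschitz_shiftE[OF f \<theta>(1)] by blast
  have "\<bar>f x\<bar> \<le> \<bar>f undefined\<bar> + L" for x
    using L(2)[of x undefined] mult_left_mono[OF shift_dist_le_1[OF \<theta>, of x undefined] L(1)] by linarith
  then show ?thesis by blast
qed

text \<open>The \<open>i\<close>-th iterates of points sharing \<open>n\<close> coordinates still
  share \<open>n - i\<close> of them. The differences are dominated by a geometric series whose sum
  does not depend on \<open>n\<close>.\<close>

lemma lipschitz_shift_distortion:
  assumes f: "lipschitz_shift \<theta> f" and \<theta>: "0 < \<theta>" "\<theta> < 1"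
  obtains D where "\<And>n x y. \<forall>i<n. x i = y i \<Longrightarrow> birkhoff_sum f n x \<le> birkhoff_sum f n y + D"
proof -
  obtain L where L: "0 \<le> L" "\<And>x y. \<bar>f x - f y\<bar> \<le> L * shift_dist \<theta> x y"
    using lipschitz_shiftE[OF f \<theta>(1)] by blast
  have "birkhoff_sum f n x \<le> birkhoff_sum f n y + L * (1 / (1 - \<theta>))" if xy: "\<forall>i<n. x i = y i" for n x y
  proof -
    \<comment> \<open>The exponent \<open>n - Suc i\<close> is slightly weaker than
      \<open>n - i\<close>; reversing the order of summation then gives the geometric series
      starting at exponent 0.\<close>
    have "f ((shift ^^ i) x) - f ((shift ^^ i) y) \<le> L * \<theta> ^ (n - Suc i)" if i: "i < n" for i
    proof -
      have "shift_dist \<theta> ((shift ^^ i) x) ((shift ^^ i) y) < \<theta> ^ (n - Suc i)"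
        using xy i by (subst shift_dist_less_iff[OF \<theta>]) (auto simp: funpow_shift)
      then have "L * shift_dist \<theta> ((shift ^^ i) x) ((shift ^^ i) y) \<le> L * \<theta> ^ (n - Suc i)"
        using L(1) by (intro mult_left_mono) auto
      then show ?thesis using L(2)[of "(shift ^^ i) x" "(shift ^^ i) y"] by linarith
    qed
    then have "birkhoff_sum f n x - birkhoff_sum f n y \<le> (\<Sum>i<n. L * \<theta> ^ (n - Suc i))"
      unfolding birkhoff_sum_def sum_subtractf[symmetric] by (intro sum_mono) auto
    also have "\<dots> = L * (\<Sum>i<n. \<theta> ^ i)"
      by (simp add: sum.nat_diff_reindex[of "\<lambda>i. \<theta> ^ i"] flip: sum_distrib_left)
    also have "(\<Sum>i<n. \<theta> ^ i) \<le> (\<Sum>i. \<theta> ^ i)"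
      using \<theta> by (intro sum_le_suminf summable_geometric) auto
    also have "(\<Sum>i. \<theta> ^ i) = 1 / (1 - \<theta>)" using \<theta> by (intro suminf_geometric) simp
    finally show ?thesis using L(1) by (simp add: mult_left_mono)
  qed
  then show ?thesis using that by blast
qed

lemma birkhoff_sum_scale: "birkhoff_sum (\<lambda>x. c * f x) n x = c * birkhoff_sum f n x"
  by (simp add: birkhoff_sum_def sum_distrib_left)

section \<open>Periodic points and maximal means\<close>

text \<open>The infimum over a closed ball grows as the radius shrinks, so the \<open>Lim\<close>
  exists and is the supremum over all radii. A periodic \<open>y\<close> lies in every ball around
  itself.\<close>

lemma tilde_I_le_periodic_cost:
  assumes \<theta>: "0 < \<theta>" and y: "y \<in> periodic_points"
  shows "tilde_I \<theta> f y \<le> ereal (periodic_cost f y)"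
proof -
  let ?g = "\<lambda>\<epsilon>. INF z\<in>{z \<in> periodic_points. shift_dist \<theta> z y \<le> \<epsilon>}. ereal (periodic_cost f z)"
  let ?S = "SUP \<epsilon>\<in>{0<..}. ?g \<epsilon>"
  have anti: "?g \<epsilon>' \<le> ?g \<epsilon>" if "\<epsilon> \<le> \<epsilon>'" for \<epsilon> \<epsilon>' using that by (intro INF_superset_mono) auto
  have "(?g \<longlongrightarrow> ?S) (at_right 0)"
  proof (rule order_tendstoI)
    fix a assume "a < ?S"
    then obtain \<epsilon>' where \<epsilon>': "0 < \<epsilon>'" "a < ?g \<epsilon>'" by (auto simp: less_SUP_iff)
    have "a < ?g \<epsilon>" if "\<epsilon> < \<epsilon>'" for \<epsilon> using anti[of \<epsilon> \<epsilon>'] that \<epsilon>'(2) by (simp add: less_le_trans)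
    then show "\<forall>\<^sub>F \<epsilon> in at_right 0. a < ?g \<epsilon>"
      using \<epsilon>'(1) unfolding eventually_at_right_field by blast
  next
    fix a assume a: "?S < a"
    have "?g \<epsilon> < a" if "0 < \<epsilon>" for \<epsilon>
    proof -
      have "?g \<epsilon> \<le> ?S" using that by (intro SUP_upper) auto
      then show ?thesis using a by (rule le_less_trans)
    qed
    then show "\<forall>\<^sub>F \<epsilon> in at_right 0. ?g \<epsilon> < a"
      unfolding eventually_at_right_field using zero_less_one by blast
  qed
  then have "tilde_I \<theta> f y = ?S" unfolding tilde_I_def by (intro tendsto_Lim) auto
  also have "?S \<le> ereal (periodic_cost f y)"
  proof (rule SUP_least)
    fix \<epsilon> :: real assume "\<epsilon> \<in> {0<..}"
    then show "?g \<epsilon> \<le> ereal (periodic_cost f y)"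
      using y by (intro INF_lower) (auto simp: shift_dist_def)
  qed
  finally show ?thesis .
qed

section \<open>Fixed points and their Dirac measures\<close>

lemma min_period_const: "min_period (\<lambda>_. b) = 1"
  unfolding min_period_def by (rule Least_equality) (auto simp: funpow_shift shift_def)

lemma periodic_cost_const: "periodic_cost f (\<lambda>_. b) = max_mean f - f (\<lambda>_. b)"
  by (simp add: periodic_cost_def min_period_const birkhoff_sum_def)

lemma const_periodic: "(\<lambda>_. b) \<in> periodic_points"
  by (auto simp: periodic_points_def funpow_shift)

lemma return_const_invariant: "return borel (\<lambda>_. b) \<in> invariant_probs"
  using distr_return[OF shift_measurable, of "\<lambda>_. b"]
  by (simp add: invariant_probs_def prob_space_return shift_def)

text \<open>The real supremum in \<open>max_mean\<close> dominates its family only once boundedness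
  is known.\<close>

lemma bdd_above_means:
  fixes f :: "point \<Rightarrow> real"
  assumes "\<And>x. \<bar>f x\<bar> \<le> B"
  shows "bdd_above ((\<lambda>\<nu>. integral\<^sup>L \<nu> f) ` invariant_probs)"
proof (rule bdd_aboveI2)
  fix \<nu> assume "\<nu> \<in> invariant_probs"
  then interpret prob_space \<nu> by (simp add: invariant_probs_def)
  have "\<bar>integral\<^sup>L \<nu> f\<bar> \<le> B"
  proof (cases "integrable \<nu> f")
    case True
    then have "\<bar>integral\<^sup>L \<nu> f\<bar> \<le> (\<integral>x. \<bar>f x\<bar> \<partial>\<nu>)" using integral_norm_bound[of \<nu> f] by simp
    also have "\<dots> \<le> (\<integral>x. B \<partial>\<nu>)" using True assms by (intro integral_mono) auto
    finally show ?thesis by (simp add: prob_space)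
  next
    \<comment> \<open>The integral of a non-integrable function is 0 by default, and
      \<open>0 \<le> B\<close>.\<close>
    case False
    then show ?thesis using assms[of undefined] by (simp add: not_integrable_integral_eq)
  qed
  then show "integral\<^sup>L \<nu> f \<le> B" by simp
qed

text \<open>The Dirac measures at the two fixed points are distinct and invariant, so uniqueness
  prevents both from being maximizing.\<close>

lemma exists_const_nonmaximizing:
  assumes meas: "f \<in> borel_measurable borel" and bounded: "\<And>x. \<bar>f x\<bar> \<le> B"
    and unique: "maximizing_probs f = {\<mu>}"
  obtains b where "f (\<lambda>_. b) < max_mean f"
proof -
  have int: "integral\<^sup>L (return borel (\<lambda>_. b)) f = f (\<lambda>_. b)" for b
    using meas by (intro integral_return) simp_all
  have le: "f (\<lambda>_. b) \<le> max_mean f" for b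
    unfolding max_mean_def int[symmetric]
    by (intro cSUP_upper return_const_invariant bdd_above_means[OF bounded])
  have "\<exists>b. f (\<lambda>_. b) \<noteq> max_mean f"
  proof (rule ccontr)
    assume "\<not> ?thesis"
    then have "return borel (\<lambda>_. b) \<in> maximizing_probs f" for b
      using return_const_invariant int by (simp add: maximizing_probs_def)
    then have "return borel (\<lambda>_. b) = \<mu>" for b using unique by blast
    then have eq: "return borel (\<lambda>_::nat. True) = return borel (\<lambda>_. False)" by simp
    \<comment> \<open>The cylinder of first symbol \<open>True\<close> has mass 1 under one Dirac
      measure and 0 under the other.\<close>
    let ?A = "{x :: point. trunc False 1 x 0}"
    have "?A \<in> sets borel" using borel_open[OF open_trunc[of "\<lambda>x. x 0" False 1]] .
    then have "emeasure (return borel (\<lambda>_::nat. b)) ?A = indicator ?A (\<lambda>_. b)" for b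
      by (intro emeasure_return) simp
    from this[of True] this[of False] eq show False by (simp add: trunc_def)
  qed
  then show ?thesis using le that by (metis order.not_eq_order_implies_strict)
qed

section \<open>Low temperature bounds and the comparison of the two deviation functions\<close>

lemma ks_entropy_nonneg:
  assumes "\<nu> \<in> invariant_probs"
  shows "0 \<le> ks_entropy \<nu> shift"
proof -
  interpret shift_invariant \<nu> by standard fact
  have "0 \<le> word_rate False"
    using word_rate_tendsto[of False] shannon_entropy_nonneg[OF simple_function_trunc]
    by (intro LIMSEQ_le_const) auto
  then show ?thesis by (simp add: ks_entropy_eq_word_rate[of False])
qed

text \<open>A maximizing measure competes in the supremum and its entropy is non-negative.\<close>

lemma max_mean_le_pressure:
  assumes "maximizing_probs f \<noteq> {}" "0 < c"
  shows "ereal (c * max_mean f) \<le> pressure (\<lambda>x. c * f x)"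
proof -
  obtain \<nu> where \<nu>: "\<nu> \<in> invariant_probs" "integral\<^sup>L \<nu> f = max_mean f"
    using assms by (auto simp: maximizing_probs_def)
  have "ereal (c * max_mean f) = 0 + ereal (integral\<^sup>L \<nu> (\<lambda>x. c * f x))" using \<nu>(2) by simp
  also have "\<dots> \<le> ks_entropy \<nu> shift + ereal (integral\<^sup>L \<nu> (\<lambda>x. c * f x))"
    by (intro add_right_mono ks_entropy_nonneg \<nu>)
  also have "\<dots> \<le> pressure (\<lambda>x. c * f x)" unfolding pressure_def by (rule SUP_upper[OF \<nu>(1)])
  finally show ?thesis .
qed

text \<open>The potential \<open>c * f\<close> has distortion \<open>c * D\<close>, so the whole
  exponent is proportional to \<open>c\<close> once the pressure is replaced by its lower bound
  \<open>c * max_mean f\<close>.\<close>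

lemma equilibrium_state_const_word_le:
  fixes m :: nat
  assumes f: "f \<in> borel_measurable borel" "\<And>x. \<bar>f x\<bar> \<le> B" "\<And>x. 0 \<le> f x"
    and D: "\<And>n x y. \<forall>i<n. x i = y i \<Longrightarrow> birkhoff_sum f n x \<le> birkhoff_sum f n y + D"
    and max: "maximizing_probs f \<noteq> {}" and c: "0 < c" and m: "1 \<le> m"
    and eq: "equilibrium_state (\<lambda>x. c * f x) \<nu>"
  shows "measure \<nu> {x. \<forall>i<m. x i = b} \<le> 2 * exp (c * (3 * D - m * (max_mean f - f (\<lambda>_. b))))"
proof -
  interpret invariant_potential \<nu> "\<lambda>x. c * f x" "c * D" b
  proof
    show "\<nu> \<in> invariant_probs" using eq by (simp add: equilibrium_state_def)
    show "(\<lambda>x. c * f x) \<in> borel_measurable borel" using f(1) by simp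
    have "\<bar>c * f x\<bar> \<le> c * B" for x using f(2)[of x] c by (simp add: abs_mult)
    then show "\<exists>B. \<forall>x. \<bar>c * f x\<bar> \<le> B" by blast
    show "0 \<le> c * f x" for x using f(3) c by simp
    show "birkhoff_sum (\<lambda>x. c * f x) n x \<le> birkhoff_sum (\<lambda>x. c * f x) n y + c * D"
      if "\<forall>i<n. x i = y i" for n x y
      using mult_left_mono[OF D[OF that], of c] c by (simp add: birkhoff_sum_scale distrib_left)
  qed
  \<comment> \<open>The equilibrium state attains the pressure with a finite entropy rate, so the
    pressure is a real number.\<close>
  define P where "P = word_rate b + (\<integral>x. c * f x \<partial>\<nu>)"
  have P: "pressure (\<lambda>x. c * f x) = ereal P"
    using eq by (simp add: equilibrium_state_def ks_entropy_eq_word_rate[of b] P_def)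
  have "prob {x. \<forall>i<m. x i = b} \<le> 2 * exp (m * (c * f (\<lambda>_. b) - P) + 3 * (c * D))"
    by (rule prob_const_word_le[OF partition_function_le_pressure[OF P] P_def[symmetric] m])
  also have "\<dots> \<le> 2 * exp (c * (3 * D - m * (max_mean f - f (\<lambda>_. b))))"
  proof -
    have "c * max_mean f \<le> P" using max_mean_le_pressure[OF max c] P by simp
    then have "m * (c * f (\<lambda>_. b) - P) \<le> m * (c * f (\<lambda>_. b) - c * max_mean f)"
      by (intro mult_left_mono) auto
    then show ?thesis by (simp add: algebra_simps)
  qed
  finally show ?thesis .
qed

lemma log_measure_le:
  assumes "measure M A \<le> 2 * exp (c * t)" "0 < c"
  shows "ereal (1 / c) * log_measure M A \<le> ereal (ln 2 / c + t)"
proof (cases "measure M A = 0")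
  case True
  then show ?thesis using assms(2) by (simp add: log_measure_def)
next
  case False
  then have pos: "0 < measure M A" by (simp add: zero_less_measure_iff)
  then have "ln (measure M A) \<le> ln (2 * exp (c * t))" using assms(1) by (intro ln_mono) auto
  then have "ln (measure M A) \<le> ln 2 + c * t" by (simp add: ln_mult)
  then have "ln (measure M A) / c \<le> ln 2 / c + t" using assms(2) by (simp add: field_simps)
  then show ?thesis using False by (simp add: log_measure_def)
qed

theorem proposition15:
  fixes \<theta> :: real
    and f :: "point \<Rightarrow> real"
    and \<mu>_inf :: "point measure"
    and \<mu> :: "real \<Rightarrow> point measure"
    and I_BLT :: "point \<Rightarrow> ereal"
  assumes "0 < \<theta>" and "\<theta> < 1"
    and "lipschitz_shift \<theta> f"
    and "\<And>x. 0 < f x"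
    and "maximizing_probs f = {\<mu>_inf}"
    and "\<And>c. 0 < c \<Longrightarrow> equilibrium_state (\<lambda>x. c * f x) (\<mu> c)"
    and "is_BLT_deviation \<mu> I_BLT"
  shows "\<exists>k. is_cylinder k \<and> (INF x\<in>k. tilde_I \<theta> f x) \<noteq> (INF x\<in>k. I_BLT x)"
proof -
  note lip = assms(3,1,2)
  obtain B where B: "\<And>x. \<bar>f x\<bar> \<le> B" using lipschitz_shift_bounded[OF lip] by blast
  obtain D where D: "\<And>n x y. \<forall>i<n. x i = y i \<Longrightarrow> birkhoff_sum f n x \<le> birkhoff_sum f n y + D"
    using lipschitz_shift_distortion[OF lip] by blast
  note meas = lipschitz_shift_measurable[OF lip]
  obtain b where b: "f (\<lambda>_. b) < max_mean f"
    using exists_const_nonmaximizing[OF meas B assms(5)] by blast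
  define \<Delta> where "\<Delta> = max_mean f - f (\<lambda>_. b)"
  have \<Delta>: "0 < \<Delta>" using b by (simp add: \<Delta>_def)
  \<comment> \<open>This length makes the decay rate \<open>m * \<Delta> - 3 * D\<close> exceed
    \<open>\<Delta>\<close>, the cost of the fixed point.\<close>
  obtain m :: nat where m': "3 * D + \<Delta> < m * \<Delta>"
    using ex_less_of_nat_mult[OF \<Delta>] by blast
  \<comment> \<open>Length 0 would force \<open>D < 0\<close>, whereas empty Birkhoff sums give
    \<open>0 \<le> D\<close>.\<close>
  have m: "1 \<le> m"
  proof (rule ccontr)
    assume "\<not> 1 \<le> m"
    then have "m = 0" by simp
    then show False using m' \<Delta> D[of 0 undefined undefined] by (simp add: birkhoff_sum_def)
  qed
  define k where "k = {x :: point. \<forall>i<m. x i = b}"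
  have k: "is_cylinder k" unfolding is_cylinder_def k_def using m by (intro exI[of _ m] conjI exI[of _ "\<lambda>_. b"]) auto
  have tilde: "(INF x\<in>k. tilde_I \<theta> f x) \<le> ereal \<Delta>"
    using tilde_I_le_periodic_cost[OF assms(1) const_periodic, of f b]
    unfolding periodic_cost_const \<Delta>_def by (intro INF_lower2[of "\<lambda>_. b"]) (auto simp: k_def)
  have lim: "((\<lambda>c. ereal (1 / c) * log_measure (\<mu> c) k) \<longlongrightarrow> - (INF x\<in>k. I_BLT x)) at_top"
    using assms(7) k by (simp add: is_BLT_deviation_def)
  \<comment> \<open>The prefactor 2 contributes only \<open>ln 2 / c\<close>, which vanishes at zero
    temperature.\<close>
  have "((\<lambda>c. ln 2 / c + (3 * D - m * \<Delta>)) \<longlongrightarrow> 0 + (3 * D - m * \<Delta>)) at_top"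
    by (intro tendsto_add tendsto_const real_tendsto_divide_at_top[OF tendsto_const filterlim_ident])
  then have bound: "((\<lambda>c. ereal (ln 2 / c + (3 * D - m * \<Delta>))) \<longlongrightarrow> ereal (3 * D - m * \<Delta>)) at_top"
    by simp
  have "\<forall>\<^sub>F c in at_top. ereal (1 / c) * log_measure (\<mu> c) k \<le> ereal (ln 2 / c + (3 * D - m * \<Delta>))"
    using eventually_gt_at_top[of 0]
  proof eventually_elim
    case (elim c)
    have "measure (\<mu> c) k \<le> 2 * exp (c * (3 * D - m * \<Delta>))"
      unfolding k_def \<Delta>_def
      by (rule equilibrium_state_const_word_le[OF meas B _ D _ elim m assms(6)[OF elim]])
        (use assms(4,5) in \<open>auto intro: less_imp_le\<close>)
    then show ?case using elim by (rule log_measure_le)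
  qed
  then have "- (INF x\<in>k. I_BLT x) \<le> ereal (3 * D - m * \<Delta>)"
    by (rule tendsto_le[OF trivial_limit_at_top_linorder bound lim])
  also have "\<dots> < - ereal \<Delta>" using m' by simp
  finally have "ereal \<Delta> < (INF x\<in>k. I_BLT x)" by (simp add: ereal_uminus_less_reorder)
  then show ?thesis using k tilde by (metis not_le)
qed

end
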